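(* Let $G$ be an infinite simple graph on countably many vertices, labeled by $\mathbb{N}=\{1,2,3,\dots\}$, and let $\Lambda\subset\mathbb{R}$ be a compact, infinite set of real numbers. Then there exists a bounded self-adjoint operator $T$ on the Hilbert space $\ell^2(\mathbb{N})$ such that (i) the spectrum of $T$ (which coincides with its approximate point spectrum) equals $\Lambda$, and (ii) the standard matrix of $T$ is real symmetric and has graph $G$.
   Context: The graph $G$ is not assumed to be locally finite. $\ell^2(\mathbb{N})$ is the Hilbert space of square-summable sequences with standard Hilbert basis $\{\boldsymbol{e}_1,\boldsymbol{e}_2,\dots\}$. The standard matrix of a bounded operator $T$ is the infinite matrix $M$, indexed by $\mathbb{N}\times\mathbb{N}$, with $M_{ij}=\langle T\boldsymbol{e}_j,\boldsymbol{e}_i\rangle$ (its $j$-th column is $T\boldsymbol{e}_j$). A simple graph $G$ with vertex set labeled by $\mathbb{N}$ is the graph of a real symmetric infinite matrix $M$ when, for every nonempty finite $S\subset\mathbb{N}$, the induced subgraph $G[S]$ is the graph of the submatrix $M[S]$ with rows and columns indexed by $S$; that is, for all $i\neq j$, $M_{ij}\neq 0$ if and only if $i$ and $j$ are adjacent in $G$ (no restriction is placed on diagonal entries). *)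

theory Defs
  imports "HOL-Analysis.Analysis"
begin

section \<open>The complex Hilbert space of square-summable sequences\<close>

text \<open>Sequences, matrices and graph vertices are indexed by \<^typ>\<open>nat\<close>, so indexing starts at 0
  instead of 1.\<close>

lemma square_summable_add:
  fixes x y :: "nat \<Rightarrow> complex"
  assumes "summable (\<lambda>i. (cmod (x i))\<^sup>2)" "summable (\<lambda>i. (cmod (y i))\<^sup>2)"
  shows "summable (\<lambda>i. (cmod (x i + y i))\<^sup>2)"
proof (rule summable_comparison_test')
  show "summable (\<lambda>i. 2 * (cmod (x i))\<^sup>2 + 2 * (cmod (y i))\<^sup>2)"
    using assms by (intro summable_add summable_mult)
  fix i :: nat
  have "(cmod (x i + y i))\<^sup>2 \<le> (cmod (x i) + cmod (y i))\<^sup>2"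
    by (intro power_mono norm_triangle_ineq) auto
  also have "\<dots> \<le> 2 * (cmod (x i))\<^sup>2 + 2 * (cmod (y i))\<^sup>2"
    using sum_squares_bound[of "cmod (x i)" "cmod (y i)"] by (simp add: power2_sum)
  finally show "norm ((cmod (x i + y i))\<^sup>2) \<le> 2 * (cmod (x i))\<^sup>2 + 2 * (cmod (y i))\<^sup>2"
    by simp
qed

lemma square_summable_scale:
  fixes x :: "nat \<Rightarrow> complex"
  assumes "summable (\<lambda>i. (cmod (x i))\<^sup>2)"
  shows "summable (\<lambda>i. (cmod (c * x i))\<^sup>2)"
  using summable_mult[OF assms, of "(cmod c)\<^sup>2"] by (simp add: norm_mult power_mult_distrib)

typedef ell2 = "{x :: nat \<Rightarrow> complex. summable (\<lambda>i. (cmod (x i))\<^sup>2)}"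
  morphisms ell2_nth Abs_ell2
  by (rule exI[of _ "\<lambda>_. 0"]) simp

setup_lifting type_definition_ell2

lemma ell2_summable: "summable (\<lambda>i. (cmod (ell2_nth x i))\<^sup>2)"
  by transfer

lift_definition scale_ell2 :: "complex \<Rightarrow> ell2 \<Rightarrow> ell2" (infixr "*\<^sub>C" 75)
  is "\<lambda>c x i. c * x i"
  by (rule square_summable_scale)

lift_definition basis_ell2 :: "nat \<Rightarrow> ell2"
  is "\<lambda>j i. if i = j then 1 else 0"
  by (rule summable_finite[of "{j}" for j]) auto

definition cinner_ell2 :: "ell2 \<Rightarrow> ell2 \<Rightarrow> complex" where
  "cinner_ell2 x y = (\<Sum>i. ell2_nth x i * cnj (ell2_nth y i))"

instantiation ell2 :: real_normed_vector
begin

lift_definition zero_ell2 :: ell2 is "\<lambda>_. 0"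
  by simp

lift_definition plus_ell2 :: "ell2 \<Rightarrow> ell2 \<Rightarrow> ell2" is "\<lambda>x y i. x i + y i"
  by (rule square_summable_add)

lift_definition uminus_ell2 :: "ell2 \<Rightarrow> ell2" is "\<lambda>x i. - x i"
  by simp

lift_definition minus_ell2 :: "ell2 \<Rightarrow> ell2 \<Rightarrow> ell2" is "\<lambda>x y i. x i - y i"
  subgoal for x y using square_summable_add[of x "\<lambda>i. - y i"] by simp
  done

lift_definition scaleR_ell2 :: "real \<Rightarrow> ell2 \<Rightarrow> ell2" is "\<lambda>r x i. of_real r * x i"
  by (rule square_summable_scale)

definition norm_ell2 :: "ell2 \<Rightarrow> real" where
  "norm_ell2 x = sqrt (\<Sum>i. (cmod (ell2_nth x i))\<^sup>2)"

definition sgn_ell2 :: "ell2 \<Rightarrow> ell2" where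
  "sgn_ell2 x = inverse (norm x) *\<^sub>R x"

definition dist_ell2 :: "ell2 \<Rightarrow> ell2 \<Rightarrow> real" where
  "dist_ell2 x y = norm (x - y)"

definition uniformity_ell2 :: "(ell2 \<times> ell2) filter" where
  "uniformity_ell2 = (INF e\<in>{0<..}. principal {(x, y). dist x y < e})"

definition open_ell2 :: "ell2 set \<Rightarrow> bool" where
  "open_ell2 U \<longleftrightarrow> (\<forall>x\<in>U. eventually (\<lambda>(x', y). x' = x \<longrightarrow> y \<in> U) uniformity)"

instance
proof
  fix x y z :: ell2 and a b :: real
  show "x + y + z = x + (y + z)" "x + y = y + x" "0 + x = x" "- x + x = 0" "x - y = x + - y"
    "a *\<^sub>R (x + y) = a *\<^sub>R x + a *\<^sub>R y" "(a + b) *\<^sub>R x = a *\<^sub>R x + b *\<^sub>R x"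
    "a *\<^sub>R b *\<^sub>R x = (a * b) *\<^sub>R x" "1 *\<^sub>R x = x"
    by (transfer; simp add: algebra_simps)+
  show "norm x = 0 \<longleftrightarrow> x = 0"
  proof -
    have "norm x = 0 \<longleftrightarrow> (\<forall>i. (cmod (ell2_nth x i))\<^sup>2 = 0)"
      unfolding norm_ell2_def
      using suminf_eq_zero_iff[OF ell2_summable[of x]] by simp
    also have "\<dots> \<longleftrightarrow> x = 0"
      by transfer (simp add: fun_eq_iff)
    finally show ?thesis .
  qed
  show "norm (a *\<^sub>R x) = \<bar>a\<bar> * norm x"
  proof -
    have "(\<Sum>i. (cmod (ell2_nth (a *\<^sub>R x) i))\<^sup>2) = (\<Sum>i. a\<^sup>2 * (cmod (ell2_nth x i))\<^sup>2)"
      by (simp add: scaleR_ell2.rep_eq norm_mult power_mult_distrib)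
    also have "\<dots> = a\<^sup>2 * (\<Sum>i. (cmod (ell2_nth x i))\<^sup>2)"
      by (rule suminf_mult[OF ell2_summable])
    finally show ?thesis
      unfolding norm_ell2_def by (simp add: real_sqrt_mult)
  qed
  show "norm (x + y) \<le> norm x + norm y"
  proof -
    have nn: "0 \<le> norm w" for w :: ell2
      unfolding norm_ell2_def by (simp add: suminf_nonneg ell2_summable)
    have L2: "L2_set (\<lambda>i. cmod (ell2_nth w i)) {..<n} \<le> norm w" for w :: ell2 and n
      unfolding norm_ell2_def L2_set_def
      by (intro real_sqrt_le_mono sum_le_suminf ell2_summable) auto
    have "(\<Sum>i<n. (cmod (ell2_nth (x + y) i))\<^sup>2) \<le> (norm x + norm y)\<^sup>2" for n
    proof -
      have "L2_set (\<lambda>i. cmod (ell2_nth (x + y) i)) {..<n}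
          \<le> L2_set (\<lambda>i. cmod (ell2_nth x i) + cmod (ell2_nth y i)) {..<n}"
        by (intro L2_set_mono) (auto simp: plus_ell2.rep_eq norm_triangle_ineq)
      also have "\<dots> \<le> L2_set (\<lambda>i. cmod (ell2_nth x i)) {..<n}
          + L2_set (\<lambda>i. cmod (ell2_nth y i)) {..<n}"
        by (rule L2_set_triangle_ineq)
      also have "\<dots> \<le> norm x + norm y"
        by (intro add_mono L2)
      finally have "sqrt (\<Sum>i<n. (cmod (ell2_nth (x + y) i))\<^sup>2) \<le> norm x + norm y"
        by (simp add: L2_set_def)
      then show ?thesis
        by (rule sqrt_le_D)
    qed
    then have "(\<Sum>i. (cmod (ell2_nth (x + y) i))\<^sup>2) \<le> (norm x + norm y)\<^sup>2"
      by (intro suminf_le_const ell2_summable)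
    then have "norm (x + y) \<le> sqrt ((norm x + norm y)\<^sup>2)"
      unfolding norm_ell2_def[of "x + y"] by (rule real_sqrt_le_mono)
    then show ?thesis
      using nn[of x] nn[of y] by simp
  qed
qed (auto simp: dist_ell2_def sgn_ell2_def uniformity_ell2_def open_ell2_def)

end

section \<open>Bounded operators and spectra\<close>

text \<open>\<^const>\<open>bounded_linear\<close> is boundedness together with linearity over the reals only; linearity
  over the complex numbers is the second conjunct.\<close>

definition bounded_operator :: "(ell2 \<Rightarrow> ell2) \<Rightarrow> bool" where
  "bounded_operator T \<longleftrightarrow> bounded_linear T \<and> (\<forall>c x. T (c *\<^sub>C x) = c *\<^sub>C T x)"

definition self_adjoint :: "(ell2 \<Rightarrow> ell2) \<Rightarrow> bool" where
  "self_adjoint T \<longleftrightarrow> (\<forall>x y. cinner_ell2 (T x) y = cinner_ell2 x (T y))"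

definition invertible_operator :: "(ell2 \<Rightarrow> ell2) \<Rightarrow> bool" where
  "invertible_operator T \<longleftrightarrow> (\<exists>S. bounded_operator S \<and> S \<circ> T = id \<and> T \<circ> S = id)"

definition op_spectrum :: "(ell2 \<Rightarrow> ell2) \<Rightarrow> complex set" where
  "op_spectrum T = {z. \<not> invertible_operator (\<lambda>x. T x - z *\<^sub>C x)}"

definition approx_point_spectrum :: "(ell2 \<Rightarrow> ell2) \<Rightarrow> complex set" where
  "approx_point_spectrum T =
    {z. \<exists>x :: nat \<Rightarrow> ell2. (\<forall>n. norm (x n) = 1) \<and> (\<lambda>n. T (x n) - z *\<^sub>C x n) \<longlonglongrightarrow> 0}"

section \<open>Standard matrices and their graphs\<close>

definition standard_matrix :: "(ell2 \<Rightarrow> ell2) \<Rightarrow> nat \<Rightarrow> nat \<Rightarrow> complex" where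
  "standard_matrix T i j = cinner_ell2 (T (basis_ell2 j)) (basis_ell2 i)"

definition real_symmetric :: "(nat \<Rightarrow> nat \<Rightarrow> complex) \<Rightarrow> bool" where
  "real_symmetric M \<longleftrightarrow> (\<forall>i j. M i j \<in> \<real> \<and> M i j = M j i)"

text \<open>A simple graph with vertex set \<^typ>\<open>nat\<close>, given by its adjacency relation.\<close>

definition simple_graph :: "(nat \<Rightarrow> nat \<Rightarrow> bool) \<Rightarrow> bool" where
  "simple_graph G \<longleftrightarrow> symp G \<and> irreflp G"

text \<open>The submatrix of \<open>M\<close> with rows and columns in \<open>S\<close> has graph \<open>G[S]\<close>.\<close>

definition submatrix_has_graph ::
    "nat set \<Rightarrow> (nat \<Rightarrow> nat \<Rightarrow> complex) \<Rightarrow> (nat \<Rightarrow> nat \<Rightarrow> bool) \<Rightarrow> bool" where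
  "submatrix_has_graph S M G \<longleftrightarrow> (\<forall>i\<in>S. \<forall>j\<in>S. i \<noteq> j \<longrightarrow> (M i j \<noteq> 0 \<longleftrightarrow> G i j))"

definition matrix_has_graph :: "(nat \<Rightarrow> nat \<Rightarrow> complex) \<Rightarrow> (nat \<Rightarrow> nat \<Rightarrow> bool) \<Rightarrow> bool" where
  "matrix_has_graph M G \<longleftrightarrow> (\<forall>S. finite S \<and> S \<noteq> {} \<longrightarrow> submatrix_has_graph S M G)"

end

theory Submission imports Defs begin

text \<open>
  The operator is a norm limit of operators that are all orthogonally equivalent to one and the
  same diagonal operator.

  Choose distinct numbers \<open>\<mu> 0, \<mu> 1, \<dots>\<close> that are dense in \<open>\<Lambda>\<close>. The operator of stage \<open>n\<close> acts on
  the first \<open>n\<close> coordinates as a real symmetric matrix \<open>A n\<close> whose graph is the subgraph of \<open>G\<close>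
  induced on the first \<open>n\<close> vertices and whose eigenvalues are exactly \<open>\<mu> 0, \<dots>, \<mu> (n - 1)\<close>, and on
  the remaining coordinates as the diagonal matrix with entries \<open>\<mu> n, \<mu> (n + 1), \<dots>\<close>. It is
  therefore conjugate to the diagonal operator of \<open>\<mu>\<close>, and its spectrum is \<open>\<Lambda>\<close>.

  The step from \<open>n\<close> to \<open>n + 1\<close> gives tiny nonzero weights to the edges between vertex \<open>n\<close> and the
  earlier vertices, and pays for this with tiny changes of the diagonal entries, on which the
  graph puts no restriction, so that no eigenvalue moves (\<open>perturb_keeping_eigenvalues\<close>). This is
  an implicit function argument. If the orthonormal eigenvectors are the columns of \<open>Q\<close>, then the
  derivative of the \<open>k\<close>-th eigenvalue with respect to the \<open>i\<close>-th diagonal entry is \<open>(Q i k)\<^sup>2\<close>. The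
  rows of this Jacobian sum to 1, so it is strictly diagonally dominant as long as
  \<open>(Q k k)\<^sup>2 > 1 / 2\<close>. That is an open condition, hence it survives if the perturbation is small
  enough, and it is carried along as an invariant.

  The weights are chosen so small that consecutive stages differ by at most \<open>(1 / 2) ^ n\<close> in operator
  norm. In the limit the off-diagonal entries are those at which the stages have become constant,
  so the limit has graph \<open>G\<close>. The spectrum passes to the limit as well. Off \<open>\<Lambda>\<close>, the inverses of the
  shifted stages are bounded by the reciprocal of the distance to \<open>\<Lambda>\<close>, uniformly in the stage, so the
  limit stays invertible (\<open>op_spectrum_limit_subset\<close>). At a point of \<open>\<Lambda>\<close>, eigenvectors of the stages
  with eigenvalues close to the point are approximate eigenvectors of the limit
  (\<open>closure_subset_approx_point_spectrum_limit\<close>).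
\<close>

section \<open>A contraction principle on boxes\<close>

text \<open>
  The Banach fixed point theorem for the supremum over the coordinates in \<open>I\<close>. The condition on the
  image of 0 keeps all iterates of 0 inside the box, and each coordinate of the iterates converges
  geometrically.
\<close>

lemma contraction_fixpoint_on_box:
  fixes F :: "('i \<Rightarrow> real) \<Rightarrow> 'i \<Rightarrow> real"
  assumes "0 < r" and c: "0 \<le> c" "c < 1"
    and start: "\<And>i. i \<in> I \<Longrightarrow> \<bar>F (\<lambda>_. 0) i\<bar> \<le> (1 - c) * r"
    and contr: "\<And>x y t i. (\<forall>j\<in>I. \<bar>x j\<bar> \<le> r) \<Longrightarrow> (\<forall>j\<in>I. \<bar>y j\<bar> \<le> r) \<Longrightarrow>
      (\<forall>j\<in>I. \<bar>x j - y j\<bar> \<le> t) \<Longrightarrow> i \<in> I \<Longrightarrow> \<bar>F x i - F y i\<bar> \<le> c * t"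
  shows "\<exists>x. (\<forall>i\<in>I. \<bar>x i\<bar> \<le> r) \<and> (\<forall>i\<in>I. F x i = x i)"
proof -
  define s where "s n = (F ^^ n) (\<lambda>_. 0)" for n
  have s0: "s 0 = (\<lambda>_. 0)" and sS: "s (Suc n) = F (s n)" for n
    by (simp_all add: s_def)
  have inbox: "\<forall>i\<in>I. \<bar>s n i\<bar> \<le> r" for n
  proof (induction n)
    case (Suc n)
    have "\<bar>F (s n) i - F (\<lambda>_. 0) i\<bar> \<le> c * r" if "i \<in> I" for i
      using Suc \<open>0 < r\<close> that by (intro contr) auto
    moreover have "\<bar>F (s n) i\<bar> \<le> r"
      if "\<bar>F (s n) i - F (\<lambda>_. 0) i\<bar> \<le> c * r" "i \<in> I" for i
      using start[OF that(2)] that(1) by (simp add: left_diff_distrib)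
    ultimately show ?case
      by (simp add: sS)
  qed (use \<open>0 < r\<close> in \<open>simp add: s0\<close>)
  have step: "\<forall>i\<in>I. \<bar>s (Suc n) i - s n i\<bar> \<le> r * c ^ n" for n
  proof (induction n)
    case 0
    then show ?case using inbox[of 1] by (simp add: s0)
  next
    case (Suc n)
    have "\<bar>F (s (Suc n)) i - F (s n) i\<bar> \<le> c * (r * c ^ n)" if "i \<in> I" for i
      using Suc inbox that by (intro contr) auto
    then show ?case by (simp add: sS mult_ac)
  qed
  have "convergent (\<lambda>n. s n i)" if "i \<in> I" for i
  proof -
    have "summable (\<lambda>n. s (Suc n) i - s n i)"
    proof (rule summable_comparison_test')
      show "summable (\<lambda>n. r * c ^ n)"
        using c by (intro summable_mult summable_geometric) simp
    qed (use step that in simp)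
    then show ?thesis
      using sum_lessThan_telescope[of "\<lambda>n. s n i"] by (simp add: summable_iff_convergent s0)
  qed
  then obtain x where lim: "(\<lambda>n. s n i) \<longlonglongrightarrow> x i" if "i \<in> I" for i
    unfolding convergent_def by metis
  have xbox: "\<bar>x i\<bar> \<le> r" if "i \<in> I" for i
    using LIMSEQ_le_const2[OF tendsto_rabs[OF lim[OF that]]] inbox that by blast
  have rate: "\<bar>x i - s n i\<bar> \<le> r * c ^ n / (1 - c)" if "i \<in> I" for i n
  proof -
    have "\<bar>s (n + m) i - s n i\<bar> \<le> r * c ^ n * (1 - c ^ m) / (1 - c)" for m
    proof (induction m)
      case (Suc m)
      have "\<bar>s (n + Suc m) i - s n i\<bar> \<le> r * c ^ (n + m) + r * c ^ n * (1 - c ^ m) / (1 - c)"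
        using bspec[OF step[of "n + m"] that] Suc by simp
      also have "\<dots> = r * c ^ n * (1 - c ^ Suc m) / (1 - c)"
        using c by (simp add: field_simps power_add)
      finally show ?case .
    qed simp
    moreover have "r * c ^ n * (1 - c ^ m) / (1 - c) \<le> r * c ^ n / (1 - c)" for m
      using c \<open>0 < r\<close> by (intro divide_right_mono mult_left_le) auto
    ultimately have bd: "\<bar>s (n + m) i - s n i\<bar> \<le> r * c ^ n / (1 - c)" for m
      using order_trans by blast
    have "(\<lambda>m. \<bar>s (n + m) i - s n i\<bar>) \<longlonglongrightarrow> \<bar>x i - s n i\<bar>"
      using LIMSEQ_ignore_initial_segment[OF lim[OF that], of n]
      by (intro tendsto_intros) (simp add: add.commute)
    then show ?thesis
      using LIMSEQ_le_const2 bd by blast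
  qed
  have "F x i = x i" if "i \<in> I" for i
  proof -
    define K where "K = c * r / (1 - c)"
    have "norm (s (Suc n) i - F x i) \<le> K * c ^ n" for n
    proof -
      have "\<bar>F (s n) i - F x i\<bar> \<le> c * (r * c ^ n / (1 - c))"
      proof (rule contr[OF inbox _ _ that])
        show "\<forall>j\<in>I. \<bar>x j\<bar> \<le> r" using xbox by blast
        show "\<forall>j\<in>I. \<bar>s n j - x j\<bar> \<le> r * c ^ n / (1 - c)"
          using rate by (simp add: abs_minus_commute)
      qed
      then show ?thesis
        unfolding K_def sS by (simp add: mult_ac)
    qed
    moreover have "(\<lambda>n. K * c ^ n) \<longlonglongrightarrow> 0"
      by (rule tendsto_mult_right_zero[OF LIMSEQ_realpow_zero[OF c]])
    ultimately have "(\<lambda>n. s (Suc n) i - F x i) \<longlonglongrightarrow> 0"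
      by (rule Lim_null_comparison[OF always_eventually[OF allI]])
    then have "(\<lambda>n. s (Suc n) i) \<longlonglongrightarrow> F x i"
      using LIM_zero_iff by blast
    moreover have "(\<lambda>n. s (Suc n) i) \<longlonglongrightarrow> x i"
      using lim[OF that] by (rule LIMSEQ_Suc)
    ultimately show ?thesis
      by (rule LIMSEQ_unique)
  qed
  then show ?thesis
    using xbox by blast
qed

section \<open>Orthogonal diagonalisation\<close>

definition orthonormal_columns :: "nat \<Rightarrow> (nat \<Rightarrow> nat \<Rightarrow> real) \<Rightarrow> bool" where
  "orthonormal_columns N Q \<longleftrightarrow>
    (\<forall>k<N. \<forall>l<N. (\<Sum>i<N. Q i k * Q i l) = (if k = l then 1 else 0))"

lemma sum_kronecker [simp]:
  fixes f :: "nat \<Rightarrow> 'a::semiring_1"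
  assumes "k < N"
  shows "(\<Sum>i<N. (if i = k then 1 else 0) * f i) = f k" "(\<Sum>i<N. (if k = i then 1 else 0) * f i) = f k"
    "(\<Sum>i<N. f i * (if i = k then 1 else 0)) = f k" "(\<Sum>i<N. f i * (if k = i then 1 else 0)) = f k"
  using assms by (simp_all add: if_distrib if_distribR cong: if_cong)

text \<open>
  The squared distance of the \<open>i\<close>-th unit vector to its projection on the span of the columns is 1
  minus the sum of the \<open>(Q i k)\<^sup>2\<close> over \<open>k\<close>, a nonnegative number. Summed over \<open>i\<close> these numbers give
  \<open>N - N = 0\<close>, so every unit vector equals its projection.
\<close>

lemma orthonormal_columns_imp_rows:
  assumes "orthonormal_columns N Q"
  shows "orthonormal_columns N (\<lambda>i k. Q k i)"
proof -
  define d where "d i j = (if i = j then 1 else 0 :: real)" for i j :: nat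
  have ortho: "(\<Sum>i<N. Q i k * Q i l) = d k l" if "k < N" "l < N" for k l
    using assms that by (auto simp: orthonormal_columns_def d_def)
  have defect: "(\<Sum>j<N. (d i j - (\<Sum>k<N. Q i k * Q j k))\<^sup>2) = 1 - (\<Sum>k<N. (Q i k)\<^sup>2)"
    if "i < N" for i
  proof -
    have "(\<Sum>j<N. (\<Sum>k<N. Q i k * Q j k)\<^sup>2) = (\<Sum>j<N. \<Sum>k<N. \<Sum>l<N. Q i k * Q i l * (Q j k * Q j l))"
      by (simp add: power2_eq_square sum_product mult_ac)
    also have "\<dots> = (\<Sum>k<N. \<Sum>j<N. \<Sum>l<N. Q i k * Q i l * (Q j k * Q j l))"
      by (rule sum.swap)
    also have "\<dots> = (\<Sum>k<N. \<Sum>l<N. \<Sum>j<N. Q i k * Q i l * (Q j k * Q j l))"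
      by (intro sum.cong[OF refl] sum.swap)
    also have "\<dots> = (\<Sum>k<N. \<Sum>l<N. Q i k * Q i l * d k l)"
      by (simp add: sum_distrib_left[symmetric] ortho)
    also have "\<dots> = (\<Sum>k<N. (Q i k)\<^sup>2)"
      by (simp add: d_def power2_eq_square)
    finally have sq: "(\<Sum>j<N. (\<Sum>k<N. Q i k * Q j k)\<^sup>2) = (\<Sum>k<N. (Q i k)\<^sup>2)" .
    have "(\<Sum>j<N. (d i j - (\<Sum>k<N. Q i k * Q j k))\<^sup>2)
        = (\<Sum>j<N. (d i j)\<^sup>2) - 2 * (\<Sum>j<N. d i j * (\<Sum>k<N. Q i k * Q j k))
          + (\<Sum>j<N. (\<Sum>k<N. Q i k * Q j k)\<^sup>2)"
      by (simp add: power2_diff sum.distrib sum_subtractf sum_distrib_left mult_ac)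
    also have "(\<Sum>j<N. (d i j)\<^sup>2) = 1"
      using that by (simp add: d_def power2_eq_square)
    also have "(\<Sum>j<N. d i j * (\<Sum>k<N. Q i k * Q j k)) = (\<Sum>k<N. (Q i k)\<^sup>2)"
      using that by (simp add: d_def power2_eq_square)
    finally show ?thesis
      using sq by simp
  qed
  have "(\<Sum>i<N. 1 - (\<Sum>k<N. (Q i k)\<^sup>2)) = 0"
  proof -
    have "(\<Sum>i<N. \<Sum>k<N. (Q i k)\<^sup>2) = (\<Sum>k<N. \<Sum>i<N. (Q i k)\<^sup>2)"
      by (rule sum.swap)
    also have "\<dots> = N"
      using ortho by (simp add: power2_eq_square d_def)
    finally show ?thesis
      by (simp add: sum_subtractf)
  qed
  then have "(\<Sum>i<N. \<Sum>j<N. (d i j - (\<Sum>k<N. Q i k * Q j k))\<^sup>2) = 0"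
    using defect by simp
  then have "d i j - (\<Sum>k<N. Q i k * Q j k) = 0" if "i < N" "j < N" for i j
    using that by (simp add: sum_nonneg_eq_0_iff sum_nonneg)
  then show ?thesis
    by (simp add: orthonormal_columns_def d_def)
qed


lemma abs_sum_le:
  fixes f :: "nat \<Rightarrow> real"
  assumes "\<And>i. i < N \<Longrightarrow> \<bar>f i\<bar> \<le> b"
  shows "\<bar>\<Sum>i<N. f i\<bar> \<le> N * b"
  using sum_norm_bound[of "{..<N}" f b] assms by simp

lemma positive_lower_bound:
  fixes f :: "'a \<Rightarrow> real"
  assumes "finite I" "\<And>i. i \<in> I \<Longrightarrow> 0 < f i"
  shows "\<exists>g>0. \<forall>i\<in>I. g \<le> f i"
  using assms
proof (induction I rule: finite_induct)
  case empty
  then show ?case by (intro exI[of _ 1]) simp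
next
  case (insert a I)
  then obtain g where "g > 0" "\<forall>i\<in>I. g \<le> f i" by auto
  then show ?case
    using insert.prems[of a] by (intro exI[of _ "min g (f a)"]) auto
qed

lemma orthonormal_columns_abs_le_1:
  assumes "orthonormal_columns N Q" "i < N" "k < N"
  shows "\<bar>Q i k\<bar> \<le> 1"
proof -
  have "(Q i k)\<^sup>2 \<le> (\<Sum>i<N. (Q i k)\<^sup>2)"
    using assms by (intro member_le_sum) auto
  also have "\<dots> = 1"
    using assms by (simp add: orthonormal_columns_def power2_eq_square)
  finally show ?thesis
    by (simp add: abs_square_le_1)
qed

lemma orthonormal_columns_expand:
  assumes "orthonormal_columns N Q" "j < N"
  shows "(\<Sum>l<N. Q j l * (\<Sum>i<N. Q i l * u i)) = u j"
proof -
  have rows: "(\<Sum>l<N. Q j l * Q i l) = (if i = j then 1 else 0)" if "i < N" for i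
    using orthonormal_columns_imp_rows[OF assms(1)] assms(2) that
    by (auto simp: orthonormal_columns_def)
  have "(\<Sum>l<N. Q j l * (\<Sum>i<N. Q i l * u i)) = (\<Sum>l<N. \<Sum>i<N. Q j l * Q i l * u i)"
    by (simp add: sum_distrib_left mult_ac)
  also have "\<dots> = (\<Sum>i<N. \<Sum>l<N. Q j l * Q i l * u i)"
    by (rule sum.swap)
  also have "\<dots> = (\<Sum>i<N. (if i = j then 1 else 0) * u i)"
    by (simp add: sum_distrib_right[symmetric] rows)
  finally show ?thesis
    using assms(2) by simp
qed

text \<open>
  \<open>A\<close> equals \<open>Q\<close> times the diagonal matrix of \<open>\<mu>\<close> times the transpose of \<open>Q\<close>, on the leading \<open>N\<close> by \<open>N\<close>
  block. The last conjunct makes the matrix of the \<open>(Q i k)\<^sup>2\<close> strictly diagonally dominant, because the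
  squares in a row or column sum to 1. This matrix is the Jacobian of the eigenvalues as functions
  of the diagonal entries of \<open>A\<close>.
\<close>

definition diagonalises ::
    "nat \<Rightarrow> (nat \<Rightarrow> real) \<Rightarrow> (nat \<Rightarrow> nat \<Rightarrow> real) \<Rightarrow> (nat \<Rightarrow> nat \<Rightarrow> real) \<Rightarrow> bool" where
  "diagonalises N \<mu> A Q \<longleftrightarrow> orthonormal_columns N Q \<and>
    (\<forall>i<N. \<forall>j<N. A i j = (\<Sum>k<N. Q i k * \<mu> k * Q j k)) \<and> (\<forall>k<N. 1 / 2 < (Q k k)\<^sup>2)"

lemma eigenvector_basis_imp_decomposition:
  assumes Q: "orthonormal_columns N Q"
    and eig: "\<And>i k. i < N \<Longrightarrow> k < N \<Longrightarrow> (\<Sum>j<N. A i j * Q j k) = \<mu> k * Q i k"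
    and "i < N" "j < N"
  shows "A i j = (\<Sum>k<N. Q i k * \<mu> k * Q j k)"
proof -
  have "A i j = (\<Sum>k<N. Q j k * (\<Sum>m<N. Q m k * A i m))"
    using orthonormal_columns_expand[OF Q \<open>j < N\<close>] by simp
  also have "\<dots> = (\<Sum>k<N. Q i k * \<mu> k * Q j k)"
    using eig[OF \<open>i < N\<close>] by (intro sum.cong) (auto simp: mult_ac)
  finally show ?thesis .
qed

lemma decomposition_imp_eigenvector:
  assumes Q: "orthonormal_columns N Q"
    and A: "\<And>i j. i < N \<Longrightarrow> j < N \<Longrightarrow> A i j = (\<Sum>k<N. Q i k * \<mu> k * Q j k)"
    and "i < N" "l < N"
  shows "(\<Sum>j<N. A i j * Q j l) = \<mu> l * Q i l"
proof -
  have "(\<Sum>j<N. A i j * Q j l) = (\<Sum>j<N. \<Sum>k<N. Q i k * \<mu> k * (Q j k * Q j l))"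
    using \<open>i < N\<close> by (simp add: A sum_distrib_left sum_distrib_right mult_ac)
  also have "\<dots> = (\<Sum>k<N. \<Sum>j<N. Q i k * \<mu> k * (Q j k * Q j l))"
    by (rule sum.swap)
  also have "\<dots> = (\<Sum>k<N. Q i k * \<mu> k * (if k = l then 1 else 0))"
    using Q \<open>l < N\<close> by (simp add: sum_distrib_left[symmetric] orthonormal_columns_def)
  finally show ?thesis
    using \<open>l < N\<close> by (simp del: mult_zero_right mult_1_right)
qed

section \<open>Perturbing a matrix without moving its eigenvalues\<close>

text \<open>
  Let \<open>B\<close> be the symmetric matrix with eigenvector matrix \<open>Q\<close> and eigenvalues \<open>\<mu>\<close>. The equation says that
  the columns of \<open>Q + Q W\<close> are eigenvectors, for the same eigenvalues, of \<open>B\<close> plus \<open>\<epsilon>\<close> times \<open>C\<close> plus the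
  diagonal matrix of \<open>h\<close>, written in the basis \<open>Q\<close>. For \<open>l \<noteq> k\<close> it
  determines \<open>W l k\<close> in terms of \<open>h\<close>, up to small terms, because the gap \<open>\<mu> l - \<mu> k\<close> does not vanish. For \<open>l = k\<close> the
  first summand is 0, and the equation says that the first-order shift of the \<open>k\<close>-th eigenvalue,
  the sum of \<open>(Q i k)\<^sup>2 * h i\<close>, is cancelled by the other terms. Solving this for \<open>h k\<close> contracts
  by diagonal dominance. The other terms are quadratic in the unknowns or carry the factor \<open>\<epsilon>\<close>.
\<close>

lemma perturbation_equation_solvable:
  fixes \<mu> :: "nat \<Rightarrow> real" and Q C :: "nat \<Rightarrow> nat \<Rightarrow> real"
  assumes Q: "orthonormal_columns N Q" and dom: "\<And>k. k < N \<Longrightarrow> 1 / 2 < (Q k k)\<^sup>2"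
    and inj: "inj_on \<mu> {..<N}"
    and C: "\<And>i j. \<bar>C i j\<bar> \<le> 1" and "0 < \<rho>"
  shows "\<exists>\<epsilon> h W. 0 < \<epsilon> \<and> \<epsilon> \<le> \<rho> \<and> (\<forall>i<N. \<bar>h i\<bar> \<le> \<rho>) \<and>
    (\<forall>l<N. \<forall>k<N. \<bar>W l k\<bar> \<le> \<rho>) \<and> (\<forall>k. W k k = 0) \<and>
    (\<forall>l<N. \<forall>k<N. (\<mu> l - \<mu> k) * W l k +
      (\<Sum>i<N. Q i l * (\<Sum>j<N. (\<epsilon> * C i j + (if i = j then h i else 0)) *
        (Q j k + (\<Sum>m<N. Q j m * W m k)))) = 0)"
proof (cases "N = 0")
  case True
  then show ?thesis
    using \<open>0 < \<rho>\<close> by (intro exI[of _ \<rho>] exI[of _ "\<lambda>_. 0"] exI[of _ "\<lambda>_ _. 0"]) auto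
next
  case False
  then have N1: "1 \<le> real N" by simp
  define I where "I = {..<N} \<times> {..<N}"
  have Q1: "\<bar>Q i k\<bar> \<le> 1" if "i < N" "k < N" for i k
    using orthonormal_columns_abs_le_1[OF Q that] .
  have "\<exists>d>0. \<forall>k\<in>{..<N}. d \<le> (Q k k)\<^sup>2 - 1 / 2"
    by (rule positive_lower_bound) (use dom in auto)
  then obtain d where "0 < d" and d: "\<And>k. k < N \<Longrightarrow> d \<le> (Q k k)\<^sup>2 - 1 / 2" by auto
  have sq1: "(Q k k)\<^sup>2 \<le> 1" if "k < N" for k
    using Q1[OF that that] by (simp add: abs_square_le_1)
  have "d \<le> 1 / 2"
    using d[of 0] sq1[of 0] False by simp
  have "\<exists>g>0. \<forall>p\<in>{p\<in>I. fst p \<noteq> snd p}. g \<le> \<bar>\<mu> (fst p) - \<mu> (snd p)\<bar>"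
    by (rule positive_lower_bound) (use inj in \<open>auto simp: I_def inj_on_def\<close>)
  then obtain g where "0 < g"
    and g: "\<And>l k. l < N \<Longrightarrow> k < N \<Longrightarrow> l \<noteq> k \<Longrightarrow> g \<le> \<bar>\<mu> l - \<mu> k\<bar>"
    by (auto simp: I_def)
  \<comment> \<open>The unknowns \<open>h k\<close> and \<open>W l k\<close> are packed into one function \<open>X\<close> on pairs: \<open>X (k, k) = h k\<close>, and
    \<open>X (l, k) = W l k / M\<close> off the diagonal. The linear dependence of \<open>W\<close> on \<open>h\<close> has norm at most
    \<open>N / g\<close>; rescaling by \<open>M\<close> turns it into a contraction for the supremum norm.\<close>
  define M where "M = 4 * N / g"
  have "0 < M" using N1 \<open>0 < g\<close> by (simp add: M_def)
  \<comment> \<open>On the box of radius \<open>r\<close> the quadratic terms and those with the factor \<open>\<epsilon> \<le> r\<close> have a Lipschitz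
    constant of at most \<open>d / 2\<close>. This leaves the contraction factor \<open>1 - d\<close>.\<close>
  define r where "r = min \<rho> (min (\<rho> / M) (d / (6 * M * real N ^ 3)))"
  have "0 < r" using \<open>0 < \<rho>\<close> \<open>0 < M\<close> \<open>0 < d\<close> N1 by (simp add: r_def)
  have "r \<le> \<rho>" "r \<le> \<rho> / M" "r \<le> d / (6 * M * real N ^ 3)"
    by (simp_all add: r_def)
  then have "M * r \<le> \<rho>" and rd: "6 * M * real N ^ 3 * r \<le> d"
    using \<open>0 < M\<close> N1 by (simp_all add: field_simps)
  define \<epsilon> where "\<epsilon> = min r (d * r / (2 * real N ^ 2))"
  have "0 < \<epsilon>" "\<epsilon> \<le> r" "\<epsilon> \<le> d * r / (2 * real N ^ 2)"
    using \<open>0 < r\<close> \<open>0 < d\<close> N1 by (simp_all add: \<epsilon>_def)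
  then have \<epsilon>d: "2 * (\<epsilon> * real N ^ 2) \<le> d * r"
    using N1 by (simp add: field_simps)
  define W where "W X l k = (if l = k then 0 else M * X (l, k))" for X :: "nat \<times> nat \<Rightarrow> real" and l k
  define Z where "Z X j k = (\<Sum>m<N. Q j m * W X m k)" for X j k
  define R where "R X l k = (\<Sum>i<N. Q i l * (\<Sum>j<N. (\<epsilon> * C i j + (if i = j then X (i, i) else 0)) *
        (Q j k + Z X j k)))" for X l k
  \<comment> \<open>Division by \<open>(Q k k)\<^sup>2\<close> is one step of the Jacobi iteration for the diagonally dominant system.\<close>
  define F where "F X p = (case p of (l, k) \<Rightarrow> if l = k then X (k, k) - R X k k / (Q k k)\<^sup>2
      else - R X l k / (M * (\<mu> l - \<mu> k)))" for X p
  have R_eq: "R X l k = (\<Sum>i<N. Q i l * Q i k * X (i, i)) + (\<Sum>i<N. Q i l * (X (i, i) * Z X i k))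
      + \<epsilon> * (\<Sum>i<N. Q i l * (\<Sum>j<N. C i j * Q j k)) + \<epsilon> * (\<Sum>i<N. Q i l * (\<Sum>j<N. C i j * Z X j k))" for X l k
  proof -
    have "(\<Sum>j<N. (\<epsilon> * C i j + (if i = j then X (i, i) else 0)) * (Q j k + Z X j k))
      = X (i, i) * Q i k + X (i, i) * Z X i k + \<epsilon> * (\<Sum>j<N. C i j * Q j k) + \<epsilon> * (\<Sum>j<N. C i j * Z X j k)"
      if "i < N" for i
    proof -
      have "(\<Sum>j<N. (if i = j then X (i, i) else 0) * (Q j k + Z X j k)) = X (i, i) * (Q i k + Z X i k)"
        using that by (simp add: if_distrib if_distribR cong: if_cong)
      then show ?thesis
        by (simp add: distrib_right distrib_left sum.distrib sum_distrib_left mult_ac)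
    qed
    then show ?thesis
      by (simp add: R_def sum.distrib sum_distrib_left distrib_left mult_ac)
  qed
  have W_diff: "\<bar>W X l k - W Y l k\<bar> \<le> M * t"
    if "\<forall>p\<in>I. \<bar>X p - Y p\<bar> \<le> t" "l < N" "k < N" for X Y t l k
  proof -
    have "\<bar>X (l, k) - Y (l, k)\<bar> \<le> t" using that by (auto simp: I_def)
    moreover from this have "0 \<le> t" by linarith
    moreover have "\<bar>M * X (l, k) - M * Y (l, k)\<bar> = M * \<bar>X (l, k) - Y (l, k)\<bar>"
      using \<open>0 < M\<close> by (simp add: right_diff_distrib[symmetric] abs_mult)
    ultimately show ?thesis
      using \<open>0 < M\<close> by (simp add: W_def)
  qed
  have prod1: "\<bar>a * b\<bar> \<le> x" if "\<bar>a\<bar> \<le> 1" "\<bar>b\<bar> \<le> x" for a b x :: real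
    using mult_mono[OF that] by (simp add: abs_mult)
  have Z_diff: "\<bar>Z X j k - Z Y j k\<bar> \<le> N * (M * t)"
    if "\<forall>p\<in>I. \<bar>X p - Y p\<bar> \<le> t" "j < N" "k < N" for X Y t j k
  proof -
    have "\<bar>\<Sum>m<N. Q j m * (W X m k - W Y m k)\<bar> \<le> N * (M * t)"
      using that by (intro abs_sum_le prod1 W_diff Q1)
    then show ?thesis
      by (simp add: Z_def right_diff_distrib sum_subtractf)
  qed
  have Z_0: "Z (\<lambda>_. 0) j k = 0" for j k
    by (auto simp: Z_def W_def intro!: sum.neutral)
  have Z_le: "\<bar>Z X j k\<bar> \<le> N * (M * r)" if "\<forall>p\<in>I. \<bar>X p\<bar> \<le> r" "j < N" "k < N" for X j k
  proof -
    show ?thesis using Z_diff[of X "\<lambda>_. 0" r j k] Z_0 that by simp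
  qed
  \<comment> \<open>The part of \<open>R\<close> that is linear in \<open>h\<close>. The rest contributes only \<open>d / 2\<close> to the Lipschitz constant.\<close>
  define L where "L X l k = (\<Sum>i<N. Q i l * Q i k * X (i, i))" for X :: "nat \<times> nat \<Rightarrow> real" and l k
  have R_diff: "\<bar>(R X l k - R Y l k) - (L X l k - L Y l k)\<bar> \<le> d / 2 * t"
    if X: "\<forall>p\<in>I. \<bar>X p\<bar> \<le> r" and Y: "\<forall>p\<in>I. \<bar>Y p\<bar> \<le> r" and XY: "\<forall>p\<in>I. \<bar>X p - Y p\<bar> \<le> t"
      and lk: "l < N" "k < N" for X Y t l k
  proof -
    have "0 \<le> t" using XY lk by (fastforce simp: I_def)
    define E1 where "E1 = (\<Sum>i<N. Q i l * (X (i, i) * Z X i k - Y (i, i) * Z Y i k))"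
    define E2 where "E2 = (\<Sum>i<N. Q i l * (\<Sum>j<N. C i j * (Z X j k - Z Y j k)))"
    have "(R X l k - R Y l k) - (L X l k - L Y l k) = E1 + \<epsilon> * E2"
      unfolding R_eq L_def E1_def E2_def
      by (simp add: right_diff_distrib sum_subtractf)
    moreover have "\<bar>E1\<bar> \<le> N * (2 * (N * M * r * t))"
      unfolding E1_def
    proof (intro abs_sum_le prod1 Q1 lk)
      fix i assume i: "i < N"
      have "\<bar>X (i, i) * Z X i k - Y (i, i) * Z Y i k\<bar>
          = \<bar>(X (i, i) - Y (i, i)) * Z X i k + Y (i, i) * (Z X i k - Z Y i k)\<bar>"
        by (simp add: algebra_simps)
      also have "\<dots> \<le> \<bar>X (i, i) - Y (i, i)\<bar> * \<bar>Z X i k\<bar> + \<bar>Y (i, i)\<bar> * \<bar>Z X i k - Z Y i k\<bar>"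
        by (metis abs_mult abs_triangle_ineq)
      also have "\<dots> \<le> t * (N * (M * r)) + r * (N * (M * t))"
        using X Y XY i lk \<open>0 \<le> t\<close> \<open>0 < r\<close>
        by (intro add_mono mult_mono Z_le Z_diff) (auto simp: I_def)
      finally show "\<bar>X (i, i) * Z X i k - Y (i, i) * Z Y i k\<bar> \<le> 2 * (N * M * r * t)"
        by (simp add: mult_ac)
    qed
    moreover have "\<bar>E2\<bar> \<le> real N * (real N * (real N * (M * t)))"
      unfolding E2_def using lk XY by (intro abs_sum_le prod1 Q1 C Z_diff)
    then have "\<bar>\<epsilon> * E2\<bar> \<le> r * (N * (N * (N * (M * t))))"
      unfolding abs_mult using \<open>0 < \<epsilon>\<close> \<open>\<epsilon> \<le> r\<close> by (intro mult_mono) auto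
    ultimately have "\<bar>(R X l k - R Y l k) - (L X l k - L Y l k)\<bar>
        \<le> N * (2 * (N * M * r * t)) + r * (N * (N * (N * (M * t))))"
      by linarith
    also have "\<dots> \<le> 3 * M * real N ^ 3 * r * t"
    proof -
      have "real N ^ 2 * (M * r * t) \<le> real N ^ 3 * (M * r * t)"
        using N1 \<open>0 < M\<close> \<open>0 < r\<close> \<open>0 \<le> t\<close> by (intro mult_right_mono power_increasing) auto
      then show ?thesis
        by (simp add: algebra_simps power2_eq_square power3_eq_cube)
    qed
    also have "\<dots> \<le> d / 2 * t"
      using mult_right_mono[OF rd \<open>0 \<le> t\<close>] by simp
    finally show ?thesis .
  qed
  have R_0: "\<bar>R (\<lambda>_. 0) l k\<bar> \<le> \<epsilon> * real N ^ 2" if "l < N" "k < N" for l k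
  proof -
    have "R (\<lambda>_. 0) l k = \<epsilon> * (\<Sum>i<N. Q i l * (\<Sum>j<N. C i j * Q j k))"
      by (simp add: R_eq Z_0)
    moreover have "\<bar>\<Sum>i<N. Q i l * (\<Sum>j<N. C i j * Q j k)\<bar> \<le> real N * (real N * 1)"
      using that by (intro abs_sum_le prod1 Q1 C)
    ultimately show ?thesis
      using \<open>0 < \<epsilon>\<close> by (simp add: abs_mult power2_eq_square)
  qed
  have gap: "4 * N \<le> \<bar>M * (\<mu> l - \<mu> k)\<bar>" if "l < N" "k < N" "l \<noteq> k" for l k
  proof -
    have "4 * N = M * g" using \<open>0 < g\<close> by (simp add: M_def)
    also have "\<dots> \<le> M * \<bar>\<mu> l - \<mu> k\<bar>"
      using g[OF that] \<open>0 < M\<close> by (intro mult_left_mono) auto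
    finally show ?thesis using \<open>0 < M\<close> by (simp add: abs_mult)
  qed
  have "\<exists>X. (\<forall>p\<in>I. \<bar>X p\<bar> \<le> r) \<and> (\<forall>p\<in>I. F X p = X p)"
  proof (rule contraction_fixpoint_on_box[where c = "1 - d"])
    show "0 < r" "0 \<le> 1 - d" "1 - d < 1"
      using \<open>0 < r\<close> \<open>0 < d\<close> \<open>d \<le> 1 / 2\<close> by simp_all
  next
    fix p assume "p \<in> I"
    then obtain l k where p: "p = (l, k)" "l < N" "k < N" by (auto simp: I_def)
    show "\<bar>F (\<lambda>_. 0) p\<bar> \<le> (1 - (1 - d)) * r"
    proof (cases "l = k")
      case True
      have "\<bar>R (\<lambda>_. 0) k k\<bar> / (Q k k)\<^sup>2 \<le> \<epsilon> * real N ^ 2 / (1 / 2)"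
        using R_0[of k k] dom[of k] p \<open>0 < \<epsilon>\<close> by (intro frac_le) auto
      then show ?thesis
        using True p \<epsilon>d by (simp add: F_def)
    next
      case False
      have "\<bar>R (\<lambda>_. 0) l k\<bar> / \<bar>M * (\<mu> l - \<mu> k)\<bar> \<le> \<epsilon> * real N ^ 2 / (4 * N)"
        using R_0[of l k] gap[of l k] p False \<open>0 < \<epsilon>\<close> N1 by (intro frac_le) auto
      also have "\<dots> \<le> \<epsilon> * real N ^ 2 / (1 / 2)"
        using N1 \<open>0 < \<epsilon>\<close> by (intro frac_le) auto
      finally show ?thesis
        using False p \<epsilon>d by (simp add: F_def)
    qed
  next
    fix X Y :: "nat \<times> nat \<Rightarrow> real" and t p
    assume X: "\<forall>p\<in>I. \<bar>X p\<bar> \<le> r" and Y: "\<forall>p\<in>I. \<bar>Y p\<bar> \<le> r" and XY: "\<forall>p\<in>I. \<bar>X p - Y p\<bar> \<le> t"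
      and "p \<in> I"
    then obtain l k where p: "p = (l, k)" "l < N" "k < N" by (auto simp: I_def)
    define E where "E = (R X l k - R Y l k) - (L X l k - L Y l k)"
    have E: "\<bar>E\<bar> \<le> d / 2 * t"
      unfolding E_def using R_diff[OF X Y XY p(2,3)] .
    have "0 \<le> t" using XY \<open>p \<in> I\<close> by fastforce
    have XYi: "\<bar>X (i, i) - Y (i, i)\<bar> \<le> t" if "i < N" for i
      using XY that by (simp add: I_def)
    show "\<bar>F X p - F Y p\<bar> \<le> (1 - d) * t"
    proof (cases "l = k")
      case True
      define q where "q = (Q k k)\<^sup>2"
      have q: "1 / 2 + d \<le> q" "q \<le> 1" using d[of k] sq1[of k] p by (auto simp: q_def)
      define U where "U = (\<Sum>i\<in>{..<N} - {k}. (Q i k)\<^sup>2 * (X (i, i) - Y (i, i)))"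
      \<comment> \<open>The diagonal coefficient \<open>q\<close> cancels against the identity in \<open>F\<close>; the other coefficients
        sum to \<open>1 - q\<close>, which is less than \<open>q\<close>.\<close>
      have "(\<Sum>i<N. (Q i k)\<^sup>2 * (X (i, i) - Y (i, i))) = q * (X (k, k) - Y (k, k)) + U"
        unfolding U_def q_def using p by (subst sum.remove[of _ k]) auto
      then have "R X k k - R Y k k = q * (X (k, k) - Y (k, k)) + U + E"
        using True by (simp add: E_def L_def power2_eq_square right_diff_distrib sum_subtractf mult_ac)
      moreover have "F X p - F Y p = (X (k, k) - Y (k, k)) - (R X k k - R Y k k) / q"
        using p True by (simp add: F_def q_def diff_divide_distrib)
      ultimately have "F X p - F Y p = - (U + E) / q"
        using q \<open>0 < d\<close> by (simp add: add_divide_distrib diff_divide_distrib)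
      moreover have "\<bar>U\<bar> \<le> (1 - q) * t"
      proof -
        have "\<bar>U\<bar> \<le> (\<Sum>i\<in>{..<N} - {k}. (Q i k)\<^sup>2 * t)"
          unfolding U_def using XYi
          by (intro order_trans[OF sum_abs] sum_mono) (auto simp: abs_mult intro: mult_left_mono)
        also have "\<dots> = (1 - q) * t"
          using Q p by (simp add: sum_distrib_right[symmetric] sum_diff1 q_def
            orthonormal_columns_def power2_eq_square)
        finally show ?thesis .
      qed
      ultimately have "\<bar>F X p - F Y p\<bar> \<le> ((1 - q) * t + d / 2 * t) / q"
        using E q \<open>0 < d\<close> by (auto simp: abs_divide intro!: divide_right_mono)
      also have "\<dots> \<le> (1 - d) * t"
      proof -
        have "(1 - q) + d / 2 \<le> (1 - d) * (1 / 2 + d)"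
        proof -
          have "d * d \<le> d * (1 / 2)" using \<open>d \<le> 1 / 2\<close> \<open>0 < d\<close> by (intro mult_left_mono) auto
          moreover have "(1 - d) * (1 / 2 + d) = 1 / 2 + d / 2 - d * d"
            by (simp add: field_simps)
          ultimately show ?thesis using q \<open>0 < d\<close> by linarith
        qed
        also have "\<dots> \<le> (1 - d) * q" using q \<open>d \<le> 1 / 2\<close> by (intro mult_left_mono) auto
        finally have "((1 - q) + d / 2) * t \<le> (1 - d) * q * t"
          using \<open>0 \<le> t\<close> by (rule mult_right_mono)
        then show ?thesis
          using q \<open>0 < d\<close> by (simp add: field_simps)
      qed
      finally show ?thesis .
    next
      case False
      have "\<bar>L X l k - L Y l k\<bar> \<le> N * t"
      proof -
        have "\<bar>\<Sum>i<N. Q i l * (Q i k * (X (i, i) - Y (i, i)))\<bar> \<le> N * t"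
          using p by (intro abs_sum_le prod1 Q1 XYi)
        then show ?thesis
          by (simp add: L_def right_diff_distrib sum_subtractf mult_ac)
      qed
      then have "\<bar>R X l k - R Y l k\<bar> \<le> N * t + d / 2 * t"
        using E unfolding E_def by linarith
      also have "\<dots> \<le> N * t + 1 * t"
        using \<open>d \<le> 1 / 2\<close> \<open>0 \<le> t\<close> by (intro add_left_mono mult_right_mono) auto
      also have "\<dots> \<le> 2 * N * t"
        using mult_right_mono[OF N1 \<open>0 \<le> t\<close>] by (simp add: mult_ac)
      finally have "\<bar>R X l k - R Y l k\<bar> / \<bar>M * (\<mu> l - \<mu> k)\<bar> \<le> 2 * N * t / (4 * N)"
        using gap[OF p(2,3) False] N1 \<open>0 \<le> t\<close> by (intro frac_le) auto
      also have "\<dots> = (1 / 2) * t" using N1 by simp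
      also have "\<dots> \<le> (1 - d) * t"
        using \<open>d \<le> 1 / 2\<close> \<open>0 \<le> t\<close> by (intro mult_right_mono) auto
      finally have "\<bar>(R X l k - R Y l k) / (M * (\<mu> l - \<mu> k))\<bar> \<le> (1 - d) * t"
        by (simp only: abs_divide)
      moreover have "F X p - F Y p = - ((R X l k - R Y l k) / (M * (\<mu> l - \<mu> k)))"
        using False p by (simp add: F_def diff_divide_distrib)
      ultimately show ?thesis
        by (simp only: abs_minus_cancel)
    qed
  qed
  then obtain X where X: "\<forall>p\<in>I. \<bar>X p\<bar> \<le> r" and fixed: "\<forall>p\<in>I. F X p = X p" by blast
  have sol: "(\<mu> l - \<mu> k) * W X l k + R X l k = 0" if lk: "l < N" "k < N" for l k
  proof -
    have F: "F X (l, k) = X (l, k)" using fixed lk by (simp add: I_def)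
    show ?thesis
    proof (cases "l = k")
      case True
      then show ?thesis using F dom[OF lk(2)] by (auto simp: F_def W_def)
    next
      case False
      then have "M * (\<mu> l - \<mu> k) \<noteq> 0"
        using gap[OF lk False] N1 by auto
      then show ?thesis using F False by (simp add: F_def W_def field_simps)
    qed
  qed
  have Wle: "\<bar>W X l k\<bar> \<le> \<rho>" if "l < N" "k < N" for l k
  proof -
    have "M * \<bar>X (l, k)\<bar> \<le> M * r"
      using X that \<open>0 < M\<close> by (intro mult_left_mono) (auto simp: I_def)
    also have "\<dots> \<le> \<rho>" by fact
    finally show ?thesis
      using \<open>0 < M\<close> \<open>0 < \<rho>\<close> by (simp add: W_def abs_mult)
  qed
  show ?thesis
  proof (intro exI conjI)
    show "0 < \<epsilon>" by fact
    show "\<epsilon> \<le> \<rho>" using \<open>\<epsilon> \<le> r\<close> \<open>r \<le> \<rho>\<close> by simp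
    show "\<forall>i<N. \<bar>X (i, i)\<bar> \<le> \<rho>" using X \<open>r \<le> \<rho>\<close> by (auto simp: I_def intro: order_trans)
    show "\<forall>l<N. \<forall>k<N. \<bar>W X l k\<bar> \<le> \<rho>" using Wle by blast
    show "\<forall>k. W X k k = 0" by (simp add: W_def)
    show "\<forall>l<N. \<forall>k<N. (\<mu> l - \<mu> k) * W X l k +
      (\<Sum>i<N. Q i l * (\<Sum>j<N. (\<epsilon> * C i j + (if i = j then X (i, i) else 0)) *
        (Q j k + (\<Sum>m<N. Q j m * W X m k)))) = 0"
      using sol unfolding R_def Z_def by blast
  qed
qed

text \<open>
  A solution of the perturbation equation gives eigenvectors with eigenvalues \<open>\<mu> k\<close>. Since the
  perturbed matrix is symmetric and the \<open>\<mu> k\<close> are distinct, these eigenvectors are orthogonal, and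
  normalising them gives the new orthogonal matrix. It is close to the old one, so dominance is kept.
\<close>

lemma perturb_keeping_eigenvalues:
  assumes D: "diagonalises N \<mu> B Q" and inj: "inj_on \<mu> {..<N}"
    and C_sym: "\<And>i j. C i j = C j i" and C_le: "\<And>i j. \<bar>C i j\<bar> \<le> 1" and "0 < \<eta>"
  shows "\<exists>\<epsilon> h Q'. 0 < \<epsilon> \<and> \<epsilon> \<le> \<eta> \<and> (\<forall>i<N. \<bar>h i\<bar> \<le> \<eta>) \<and>
    diagonalises N \<mu> (\<lambda>i j. B i j + (\<epsilon> * C i j + (if i = j then h i else 0))) Q'"
proof -
  have Q: "orthonormal_columns N Q" and dom: "\<And>k. k < N \<Longrightarrow> 1 / 2 < (Q k k)\<^sup>2"
    and B: "\<And>i j. i < N \<Longrightarrow> j < N \<Longrightarrow> B i j = (\<Sum>k<N. Q i k * \<mu> k * Q j k)"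
    using D by (auto simp: diagonalises_def)
  have "\<exists>d>0. \<forall>k\<in>{..<N}. d \<le> (Q k k)\<^sup>2 - 1 / 2"
    by (rule positive_lower_bound) (use dom in auto)
  then obtain d where "0 < d" and d: "\<And>k. k < N \<Longrightarrow> d \<le> (Q k k)\<^sup>2 - 1 / 2" by auto
  \<comment> \<open>The new diagonal entries satisfy \<open>(V k k)\<^sup>2 \<ge> (Q k k)\<^sup>2 - 2 * N * \<rho>\<close>, and the columns of \<open>V\<close> have
    squared norm at most \<open>1 + N * \<rho>\<close>; the quotient exceeds \<open>1 / 2\<close> once \<open>3 * N * \<rho> < d\<close>.\<close>
  define \<rho> where "\<rho> = min \<eta> (min 1 (d / (3 * N + 1)))"
  have "0 < \<rho>" "\<rho> \<le> \<eta>" "\<rho> \<le> 1" "\<rho> \<le> d / (3 * N + 1)"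
    using \<open>0 < \<eta>\<close> \<open>0 < d\<close> by (simp_all add: \<rho>_def)
  then have "3 * N * \<rho> + \<rho> \<le> d"
    by (simp add: field_simps)
  then have \<rho>d: "3 * (N * \<rho>) < d" using \<open>0 < \<rho>\<close> by linarith
  obtain \<epsilon> h W where \<epsilon>: "0 < \<epsilon>" "\<epsilon> \<le> \<rho>" and h: "\<And>i. i < N \<Longrightarrow> \<bar>h i\<bar> \<le> \<rho>"
    and W: "\<And>l k. l < N \<Longrightarrow> k < N \<Longrightarrow> \<bar>W l k\<bar> \<le> \<rho>" and W0: "\<And>k. W k k = 0"
    and eq: "\<And>l k. l < N \<Longrightarrow> k < N \<Longrightarrow> (\<mu> l - \<mu> k) * W l k +
      (\<Sum>i<N. Q i l * (\<Sum>j<N. (\<epsilon> * C i j + (if i = j then h i else 0)) *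
        (Q j k + (\<Sum>m<N. Q j m * W m k)))) = 0"
    using perturbation_equation_solvable[where C = C, OF Q dom inj C_le \<open>0 < \<rho>\<close>] by blast
  define S where "S i j = \<epsilon> * C i j + (if i = j then h i else 0)" for i j
  define V where "V j k = Q j k + (\<Sum>m<N. Q j m * W m k)" for j k
  define A where "A i j = B i j + S i j" for i j
  define \<delta> where "\<delta> l k = (if l = k then 1 else 0 :: real)" for l k :: nat
  have cols: "(\<Sum>i<N. Q i k * Q i l) = \<delta> k l" if "k < N" "l < N" for k l
    using Q that by (simp add: orthonormal_columns_def \<delta>_def)
  have B_sym: "B i j = B j i" if "i < N" "j < N" for i j
    using B that by (simp add: mult_ac)
  have A_sym: "A i j = A j i" if "i < N" "j < N" for i j
    using B_sym[OF that] C_sym[of i j] by (simp add: A_def S_def)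
  have QV: "(\<Sum>i<N. Q i l * V i k) = \<delta> l k + W l k" if "l < N" "k < N" for l k
  proof -
    have "(\<Sum>i<N. Q i l * (\<Sum>m<N. Q i m * W m k)) = (\<Sum>i<N. \<Sum>m<N. Q i l * Q i m * W m k)"
      by (simp add: sum_distrib_left mult_ac)
    also have "\<dots> = (\<Sum>m<N. \<Sum>i<N. Q i l * Q i m * W m k)"
      by (rule sum.swap)
    also have "\<dots> = (\<Sum>m<N. \<delta> l m * W m k)"
      using that by (simp add: sum_distrib_right[symmetric] cols)
    also have "\<dots> = W l k"
      using that by (simp add: \<delta>_def)
    finally show ?thesis
      using cols[of l k] that by (simp add: V_def distrib_left sum.distrib)
  qed
  have BQ: "(\<Sum>j<N. B i j * Q j l) = \<mu> l * Q i l" if "i < N" "l < N" for i l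
    using decomposition_imp_eigenvector[OF Q B that] by blast
  have QBV: "(\<Sum>i<N. Q i l * (\<Sum>j<N. B i j * V j k)) = \<mu> l * (\<delta> l k + W l k)" if "l < N" "k < N" for l k
  proof -
    have "(\<Sum>i<N. Q i l * (\<Sum>j<N. B i j * V j k)) = (\<Sum>i<N. \<Sum>j<N. B i j * Q i l * V j k)"
      by (simp add: sum_distrib_left mult_ac)
    also have "\<dots> = (\<Sum>j<N. \<Sum>i<N. B i j * Q i l * V j k)"
      by (rule sum.swap)
    also have "\<dots> = (\<Sum>j<N. (\<Sum>i<N. B j i * Q i l) * V j k)"
      by (simp add: sum_distrib_right B_sym)
    also have "\<dots> = (\<Sum>j<N. \<mu> l * Q j l * V j k)"
      using BQ that by simp
    also have "\<dots> = \<mu> l * (\<Sum>j<N. Q j l * V j k)"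
      by (simp add: sum_distrib_left mult_ac)
    finally show ?thesis
      using QV[OF that] by simp
  qed
  \<comment> \<open>Two vectors with the same coordinates in the basis \<open>Q\<close> are equal.\<close>
  have eig: "(\<Sum>j<N. A i j * V j k) = \<mu> k * V i k" if "i < N" "k < N" for i k
  proof -
    have "(\<Sum>i<N. Q i l * (\<Sum>j<N. A i j * V j k)) = (\<Sum>i<N. Q i l * (\<mu> k * V i k))" if "l < N" for l
    proof -
      have "(\<Sum>i<N. Q i l * (\<Sum>j<N. A i j * V j k))
          = (\<Sum>i<N. Q i l * (\<Sum>j<N. B i j * V j k)) + (\<Sum>i<N. Q i l * (\<Sum>j<N. S i j * V j k))"
        by (simp add: A_def distrib_right distrib_left sum.distrib)
      also have "\<dots> = \<mu> l * (\<delta> l k + W l k) + (- (\<mu> l - \<mu> k) * W l k)"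
        using QBV[OF that \<open>k < N\<close>] eq[OF that \<open>k < N\<close>] unfolding S_def V_def by linarith
      also have "\<dots> = \<mu> k * (\<delta> l k + W l k)"
        by (simp add: \<delta>_def algebra_simps)
      also have "\<dots> = (\<Sum>i<N. Q i l * (\<mu> k * V i k))"
        using QV[OF that \<open>k < N\<close>, symmetric] by (simp add: sum_distrib_left mult_ac)
      finally show ?thesis .
    qed
    then have "(\<Sum>l<N. Q i l * (\<Sum>i<N. Q i l * (\<Sum>j<N. A i j * V j k)))
        = (\<Sum>l<N. Q i l * (\<Sum>i<N. Q i l * (\<mu> k * V i k)))"
      by simp
    then show ?thesis
      by (simp add: orthonormal_columns_expand[OF Q \<open>i < N\<close>])
  qed
  have orth: "(\<Sum>i<N. V i k * V i l) = 0" if "k < N" "l < N" "k \<noteq> l" for k l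
  proof -
    have "\<mu> l * (\<Sum>i<N. V i k * V i l) = (\<Sum>i<N. V i k * (\<Sum>j<N. A i j * V j l))"
      using eig that by (simp add: sum_distrib_left mult_ac)
    also have "\<dots> = (\<Sum>i<N. \<Sum>j<N. A i j * V i k * V j l)"
      by (simp add: sum_distrib_left mult_ac)
    also have "\<dots> = (\<Sum>j<N. \<Sum>i<N. A i j * V i k * V j l)"
      by (rule sum.swap)
    also have "\<dots> = (\<Sum>j<N. (\<Sum>i<N. A j i * V i k) * V j l)"
      by (simp add: sum_distrib_right A_sym)
    also have "\<dots> = \<mu> k * (\<Sum>i<N. V i k * V i l)"
      using eig that by (simp add: sum_distrib_left mult_ac)
    finally show ?thesis
      using inj that by (auto simp: inj_on_def)
  qed
  define s where "s k = (\<Sum>i<N. (V i k)\<^sup>2)" for k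
  have s_eq: "s k = 1 + (\<Sum>l<N. (W l k)\<^sup>2)" if "k < N" for k
  proof -
    have "s k = (\<Sum>j<N. V j k * (\<Sum>l<N. Q j l * (\<Sum>i<N. Q i l * V i k)))"
      by (simp add: s_def orthonormal_columns_expand[OF Q] power2_eq_square)
    also have "\<dots> = (\<Sum>j<N. \<Sum>l<N. Q j l * V j k * (\<delta> l k + W l k))"
      using QV that by (simp add: sum_distrib_left mult_ac)
    also have "\<dots> = (\<Sum>l<N. \<Sum>j<N. Q j l * V j k * (\<delta> l k + W l k))"
      by (rule sum.swap)
    also have "\<dots> = (\<Sum>l<N. (\<delta> l k + W l k)\<^sup>2)"
      using QV that by (simp add: sum_distrib_right[symmetric] power2_eq_square)
    also have "\<dots> = (\<Sum>l<N. \<delta> l k + (W l k)\<^sup>2)"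
      using W0 by (intro sum.cong) (auto simp: \<delta>_def)
    finally show ?thesis
      using that by (simp add: sum.distrib \<delta>_def)
  qed
  have s1: "1 \<le> s k" "s k \<le> 1 + N * \<rho>" if "k < N" for k
  proof -
    show "1 \<le> s k" using s_eq[OF that] by (simp add: sum_nonneg)
    have "\<bar>\<Sum>l<N. (W l k)\<^sup>2\<bar> \<le> N * \<rho>"
    proof (rule abs_sum_le)
      fix l assume "l < N"
      have "(W l k)\<^sup>2 = \<bar>W l k\<bar> * \<bar>W l k\<bar>" by (simp add: power2_eq_square)
      also have "\<dots> \<le> \<rho> * 1"
        using W[OF \<open>l < N\<close> that] \<open>\<rho> \<le> 1\<close> \<open>0 < \<rho>\<close> by (intro mult_mono) auto
      finally show "\<bar>(W l k)\<^sup>2\<bar> \<le> \<rho>" by simp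
    qed
    then show "s k \<le> 1 + N * \<rho>" using s_eq[OF that] by simp
  qed
  define Q' where "Q' i k = V i k / sqrt (s k)" for i k
  have prod: "sqrt (s k) * sqrt (s k) = s k" if "k < N" for k
    using s1(1)[OF that] by simp
  have "orthonormal_columns N Q'"
    unfolding orthonormal_columns_def
  proof (intro allI impI)
    fix k l assume kl: "k < N" "l < N"
    have "(\<Sum>i<N. Q' i k * Q' i l) = (\<Sum>i<N. V i k * V i l) / (sqrt (s k) * sqrt (s l))"
      by (simp add: Q'_def sum_divide_distrib)
    also have "\<dots> = (if k = l then 1 else 0)"
      using orth[OF kl] prod[OF kl(1)] s1(1)[OF kl(1)] by (auto simp: s_def power2_eq_square)
    finally show "(\<Sum>i<N. Q' i k * Q' i l) = (if k = l then 1 else 0)" .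
  qed
  moreover have "A i j = (\<Sum>k<N. Q' i k * \<mu> k * Q' j k)" if "i < N" "j < N" for i j
  proof (rule eigenvector_basis_imp_decomposition[OF \<open>orthonormal_columns N Q'\<close> _ that])
    fix i k assume ik: "i < N" "k < N"
    have "(\<Sum>j<N. A i j * Q' j k) = (\<Sum>j<N. A i j * V j k) / sqrt (s k)"
      by (simp add: Q'_def sum_divide_distrib)
    then show "(\<Sum>j<N. A i j * Q' j k) = \<mu> k * Q' i k"
      using eig[OF ik] by (simp add: Q'_def)
  qed
  moreover have "1 / 2 < (Q' k k)\<^sup>2" if "k < N" for k
  proof -
    define v where "v = (\<Sum>m<N. Q k m * W m k)"
    have "\<bar>Q k m * W m k\<bar> \<le> \<rho>" if "m < N" for m
      using mult_mono[OF orthonormal_columns_abs_le_1[OF Q \<open>k < N\<close> that] W[OF that \<open>k < N\<close>]]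
      by (simp add: abs_mult)
    then have v: "\<bar>v\<bar> \<le> N * \<rho>"
      unfolding v_def by (rule abs_sum_le)
    have "\<bar>Q k k * v\<bar> \<le> 1 * (N * \<rho>)"
      unfolding abs_mult using v orthonormal_columns_abs_le_1[OF Q that that] by (intro mult_mono) auto
    then have "- (N * \<rho>) \<le> Q k k * v" by linarith
    moreover have "(V k k)\<^sup>2 = (Q k k)\<^sup>2 + 2 * (Q k k * v) + v\<^sup>2"
      by (simp add: V_def v_def power2_sum)
    moreover have "0 \<le> v\<^sup>2" by simp
    ultimately have "(Q k k)\<^sup>2 - 2 * (N * \<rho>) \<le> (V k k)\<^sup>2" by linarith
    then have "s k < 2 * (V k k)\<^sup>2"
      using d[OF that] \<rho>d s1(2)[OF that] mult_nonneg_nonneg[of "real N" \<rho>] \<open>0 < \<rho>\<close> by linarith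
    then show ?thesis
      using s1(1)[OF that] by (simp add: Q'_def power_divide field_simps)
  qed
  ultimately have "diagonalises N \<mu> A Q'"
    by (simp add: diagonalises_def)
  then have "diagonalises N \<mu> (\<lambda>i j. B i j + (\<epsilon> * C i j + (if i = j then h i else 0))) Q'"
    by (simp add: A_def S_def diagonalises_def)
  moreover have "\<epsilon> \<le> \<eta>" "\<forall>i<N. \<bar>h i\<bar> \<le> \<eta>"
    using \<epsilon> h \<open>\<rho> \<le> \<eta>\<close> by force+
  ultimately show ?thesis
    using \<epsilon>(1) by blast
qed

section \<open>The nested sequence of matrices\<close>

text \<open>
  The direct sum of the leading \<open>n\<close> by \<open>n\<close> block of \<open>A\<close> and the diagonal matrix of \<open>d\<close>.
\<close>

definition pad :: "nat \<Rightarrow> (nat \<Rightarrow> real) \<Rightarrow> (nat \<Rightarrow> nat \<Rightarrow> real) \<Rightarrow> nat \<Rightarrow> nat \<Rightarrow> real" where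
  "pad n d A i j = (if i < n \<and> j < n then A i j else if i = j then d i else 0)"

lemma pad_simps [simp]:
  "i < n \<Longrightarrow> j < n \<Longrightarrow> pad n d A i j = A i j"
  "pad n d A i n = (if i = n then d n else 0)"
  "pad n d A n j = (if j = n then d n else 0)"
  by (auto simp: pad_def)

lemma diagonalises_Suc:
  assumes "diagonalises n \<mu> A Q"
  shows "diagonalises (Suc n) \<mu> (pad n \<mu> A) (pad n (\<lambda>_. 1) Q)"
proof -
  let ?Q = "pad n (\<lambda>_. 1) Q"
  have Q: "(\<Sum>i<n. Q i k * Q i l) = (if k = l then 1 else 0)" if "k < n" "l < n" for k l
    using assms that by (simp add: diagonalises_def orthonormal_columns_def)
  have A: "A i j = (\<Sum>k<n. Q i k * \<mu> k * Q j k)" if "i < n" "j < n" for i j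
    using assms that by (simp add: diagonalises_def)
  have "(\<Sum>i<Suc n. ?Q i k * ?Q i l) = (if k = l then 1 else 0)"
    if kl: "k < Suc n" "l < Suc n" for k l
    by (cases "k = n"; cases "l = n") (use Q kl in simp_all)
  moreover have "pad n \<mu> A i j = (\<Sum>k<Suc n. ?Q i k * \<mu> k * ?Q j k)"
    if ij: "i < Suc n" "j < Suc n" for i j
    by (cases "i = n"; cases "j = n") (use A ij in simp_all)
  moreover have "1 / 2 < (?Q k k)\<^sup>2" if "k < Suc n" for k
    using assms that by (cases "k = n") (simp_all add: diagonalises_def)
  ultimately show ?thesis
    unfolding diagonalises_def orthonormal_columns_def by blast
qed

text \<open>
  The new eigenvalue \<open>\<mu> n\<close> is first adjoined as a direct summand. The perturbation then adds only the
  edges at vertex \<open>n\<close>, all with the same weight, and changes the diagonal. Older off-diagonal entries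
  are untouched, which makes every entry off the diagonal eventually constant along the sequence.
\<close>

lemma bordered_extension:
  assumes D: "diagonalises n \<mu> A Q" and inj: "inj \<mu>" and G: "simple_graph G"
    and graph: "\<forall>i<n. \<forall>j<n. i \<noteq> j \<longrightarrow> (A i j \<noteq> 0 \<longleftrightarrow> G i j)" and "0 < \<eta>"
  shows "\<exists>A' Q'. diagonalises (Suc n) \<mu> A' Q' \<and>
    (\<forall>i<Suc n. \<forall>j<Suc n. i \<noteq> j \<longrightarrow> (A' i j \<noteq> 0 \<longleftrightarrow> G i j)) \<and>
    (\<forall>i<Suc n. \<forall>j<Suc n. \<bar>A' i j - pad n \<mu> A i j\<bar> \<le> \<eta>) \<and>
    (\<forall>i<n. \<forall>j<n. i \<noteq> j \<longrightarrow> A' i j = A i j)"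
proof -
  have sym: "G i j \<longleftrightarrow> G j i" and irr: "\<not> G i i" for i j
    using G unfolding simple_graph_def symp_def irreflp_def by blast+
  define C :: "nat \<Rightarrow> nat \<Rightarrow> real" where "C i j = of_bool (G i j \<and> max i j = n)" for i j
  have Csym: "C i j = C j i" and Cle: "\<bar>C i j\<bar> \<le> 1" for i j
    using sym by (auto simp: C_def max.commute)
  have C0: "C i j = 0" if "i < n" "j < n" for i j
    using that by (simp add: C_def max_def)
  obtain \<epsilon> h Q' where \<epsilon>: "0 < \<epsilon>" "\<epsilon> \<le> \<eta>" and h: "\<forall>i<Suc n. \<bar>h i\<bar> \<le> \<eta>"
    and D': "diagonalises (Suc n) \<mu> (\<lambda>i j. pad n \<mu> A i j + (\<epsilon> * C i j + (if i = j then h i else 0))) Q'"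
    using perturb_keeping_eigenvalues[where C = C, OF diagonalises_Suc[OF D]
      inj_on_subset[OF inj subset_UNIV] Csym Cle \<open>0 < \<eta>\<close>] by blast
  define A' where "A' i j = pad n \<mu> A i j + (\<epsilon> * C i j + (if i = j then h i else 0))" for i j
  have diag: "diagonalises (Suc n) \<mu> A' Q'"
    using D' unfolding A'_def .
  have same: "A' i j = A i j" if "i < n" "j < n" "i \<noteq> j" for i j
    using that C0 by (simp add: A'_def)
  have graph': "A' i j \<noteq> 0 \<longleftrightarrow> G i j" if "i < Suc n" "j < Suc n" "i \<noteq> j" for i j
  proof (cases "i < n \<and> j < n")
    case True
    then have "A' i j = A i j" "A i j \<noteq> 0 \<longleftrightarrow> G i j"
      using same graph that(3) by blast+
    then show ?thesis by (simp only:)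
  next
    case False
    then have "max i j = n" "pad n \<mu> A i j = 0"
      using that by (auto simp: pad_def)
    then show ?thesis
      using \<epsilon>(1) that by (simp add: A'_def C_def)
  qed
  have close: "\<bar>A' i j - pad n \<mu> A i j\<bar> \<le> \<eta>" if "i < Suc n" "j < Suc n" for i j
  proof (cases "i = j")
    case True
    then show ?thesis using h that irr by (simp add: A'_def C_def)
  next
    case False
    then show ?thesis using \<epsilon> \<open>0 < \<eta>\<close> by (simp add: A'_def C_def)
  qed
  show ?thesis
    by (intro exI[of _ A'] exI[of _ Q'] conjI allI impI diag) (rule same graph' close; assumption)+
qed

lemma nested_diagonalised_matrices:
  fixes \<eta> :: "nat \<Rightarrow> real"
  assumes inj: "inj \<mu>" and G: "simple_graph G" and \<eta>: "\<And>n. 0 < \<eta> n"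
  shows "\<exists>A Q. \<forall>n. diagonalises n \<mu> (A n) (Q n) \<and>
    (\<forall>i<n. \<forall>j<n. i \<noteq> j \<longrightarrow> (A n i j \<noteq> 0 \<longleftrightarrow> G i j)) \<and>
    (\<forall>i<Suc n. \<forall>j<Suc n. \<bar>A (Suc n) i j - pad n \<mu> (A n) i j\<bar> \<le> \<eta> n) \<and>
    (\<forall>i<n. \<forall>j<n. i \<noteq> j \<longrightarrow> A (Suc n) i j = A n i j)"
proof -
  define P where "P n S \<longleftrightarrow> (case S of (A, Q) \<Rightarrow> diagonalises n \<mu> A Q \<and>
    (\<forall>i<n. \<forall>j<n. i \<noteq> j \<longrightarrow> (A i j \<noteq> 0 \<longleftrightarrow> G i j)))"
    for n :: nat and S :: "(nat \<Rightarrow> nat \<Rightarrow> real) \<times> (nat \<Rightarrow> nat \<Rightarrow> real)"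
  define R where "R n S S' \<longleftrightarrow>
    (\<forall>i<Suc n. \<forall>j<Suc n. \<bar>fst S' i j - pad n \<mu> (fst S) i j\<bar> \<le> \<eta> n) \<and>
    (\<forall>i<n. \<forall>j<n. i \<noteq> j \<longrightarrow> fst S' i j = fst S i j)"
    for n and S S' :: "(nat \<Rightarrow> nat \<Rightarrow> real) \<times> (nat \<Rightarrow> nat \<Rightarrow> real)"
  have "\<exists>f. \<forall>n. P n (f n) \<and> R n (f n) (f (Suc n))"
  proof (rule dependent_nat_choice)
    show "\<exists>S. P 0 S"
      by (simp add: P_def diagonalises_def orthonormal_columns_def)
  next
    fix S n assume "P n S"
    obtain A Q where S: "S = (A, Q)" by (cases S)
    have D: "diagonalises n \<mu> A Q"
      and graph: "\<forall>i<n. \<forall>j<n. i \<noteq> j \<longrightarrow> (A i j \<noteq> 0 \<longleftrightarrow> G i j)"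
      using \<open>P n S\<close> unfolding P_def S prod.case by blast+
    from bordered_extension[OF D inj G graph \<eta>[of n]]
    obtain A' Q' where "diagonalises (Suc n) \<mu> A' Q' \<and>
      (\<forall>i<Suc n. \<forall>j<Suc n. i \<noteq> j \<longrightarrow> (A' i j \<noteq> 0 \<longleftrightarrow> G i j)) \<and>
      (\<forall>i<Suc n. \<forall>j<Suc n. \<bar>A' i j - pad n \<mu> A i j\<bar> \<le> \<eta> n) \<and>
      (\<forall>i<n. \<forall>j<n. i \<noteq> j \<longrightarrow> A' i j = A i j)"
      by (elim exE) (erule that)
    then have "P (Suc n) (A', Q') \<and> R n S (A', Q')"
      unfolding P_def R_def S prod.case fst_conv by (elim conjE) (intro conjI; assumption)
    then show "\<exists>S'. P (Suc n) S' \<and> R n S S'"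
      by (rule exI)
  qed
  then obtain f where f: "\<And>n. P n (f n)" "\<And>n. R n (f n) (f (Suc n))" by blast
  show ?thesis
  proof (intro exI allI)
    fix n
    show "diagonalises n \<mu> (fst (f n)) (snd (f n)) \<and>
      (\<forall>i<n. \<forall>j<n. i \<noteq> j \<longrightarrow> (fst (f n) i j \<noteq> 0 \<longleftrightarrow> G i j)) \<and>
      (\<forall>i<Suc n. \<forall>j<Suc n. \<bar>fst (f (Suc n)) i j - pad n \<mu> (fst (f n)) i j\<bar> \<le> \<eta> n) \<and>
      (\<forall>i<n. \<forall>j<n. i \<noteq> j \<longrightarrow> fst (f (Suc n)) i j = fst (f n) i j)"
      using f[of n] unfolding P_def R_def case_prod_beta by (elim conjE) (intro conjI; assumption)
  qed
qed

section \<open>The Hilbert space of square-summable sequences\<close>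

lemma ell2_eqI: "(\<And>i. ell2_nth x i = ell2_nth y i) \<Longrightarrow> x = y"
  by (metis ell2_nth_inject ext)

lemmas ell2_nth_simps [simp] =
  zero_ell2.rep_eq plus_ell2.rep_eq minus_ell2.rep_eq uminus_ell2.rep_eq scaleR_ell2.rep_eq
  scale_ell2.rep_eq basis_ell2.rep_eq

lemma norm_ell2_sq: "(norm x)\<^sup>2 = (\<Sum>i. (cmod (ell2_nth x i))\<^sup>2)"
  by (simp add: norm_ell2_def suminf_nonneg ell2_summable)

lemma L2_set_le_norm_ell2: "L2_set (\<lambda>i. cmod (ell2_nth x i)) {..<n} \<le> norm x"
  unfolding norm_ell2_def L2_set_def
  by (intro real_sqrt_le_mono sum_le_suminf ell2_summable) auto

text \<open>
  A bound on all partial sums passes to pointwise limits, which is what completeness rests on.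
\<close>

lemma norm_ell2_le_iff: "norm x \<le> b \<longleftrightarrow> 0 \<le> b \<and> (\<forall>n. (\<Sum>i<n. (cmod (ell2_nth x i))\<^sup>2) \<le> b\<^sup>2)"
proof
  assume "norm x \<le> b"
  then show "0 \<le> b \<and> (\<forall>n. (\<Sum>i<n. (cmod (ell2_nth x i))\<^sup>2) \<le> b\<^sup>2)"
    using order_trans[OF L2_set_le_norm_ell2 \<open>norm x \<le> b\<close>] order_trans[OF norm_ge_zero \<open>norm x \<le> b\<close>]
    by (auto simp: L2_set_def intro: sqrt_le_D)
next
  assume "0 \<le> b \<and> (\<forall>n. (\<Sum>i<n. (cmod (ell2_nth x i))\<^sup>2) \<le> b\<^sup>2)"
  then have "(norm x)\<^sup>2 \<le> b\<^sup>2" "0 \<le> b"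
    unfolding norm_ell2_sq by (auto intro: suminf_le_const ell2_summable)
  then show "norm x \<le> b"
    using power2_le_imp_le by blast
qed

lemma cmod_ell2_nth_le: "cmod (ell2_nth x i) \<le> norm x"
proof -
  have "(cmod (ell2_nth x i))\<^sup>2 \<le> (\<Sum>i<Suc i. (cmod (ell2_nth x i))\<^sup>2)"
    by (simp add: sum_nonneg)
  also have "\<dots> \<le> (norm x)\<^sup>2"
    using norm_ell2_le_iff[of x "norm x"] by blast
  finally show ?thesis
    using power2_le_imp_le norm_ge_zero by blast
qed

lemma norm_basis_ell2: "norm (basis_ell2 j) = 1"
proof -
  have "(\<Sum>i. (cmod (if i = j then 1 else 0 :: complex))\<^sup>2) = (\<Sum>i\<in>{j}. 1)"
    by (subst suminf_finite[of "{j}"]) auto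
  then show ?thesis
    by (simp add: norm_ell2_def)
qed

lemma norm_scale_ell2: "norm (c *\<^sub>C x) = cmod c * norm x"
proof -
  have "(norm (c *\<^sub>C x))\<^sup>2 = (cmod c)\<^sup>2 * (norm x)\<^sup>2"
    by (simp add: norm_ell2_sq norm_mult power_mult_distrib suminf_mult[OF ell2_summable])
  then have "(norm (c *\<^sub>C x))\<^sup>2 = (cmod c * norm x)\<^sup>2"
    by (simp add: power_mult_distrib)
  then show ?thesis
    by (rule power2_eq_imp_eq) auto
qed

lemma summable_cinner_norm: "summable (\<lambda>i. norm (ell2_nth x i * cnj (ell2_nth y i)))"
proof (rule summable_comparison_test')
  show "summable (\<lambda>i. (cmod (ell2_nth x i))\<^sup>2 + (cmod (ell2_nth y i))\<^sup>2)"
    by (intro summable_add ell2_summable)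
  fix i
  have "2 * (cmod (ell2_nth x i) * cmod (ell2_nth y i)) \<le> (cmod (ell2_nth x i))\<^sup>2 + (cmod (ell2_nth y i))\<^sup>2"
    using sum_squares_bound[of "cmod (ell2_nth x i)" "cmod (ell2_nth y i)"] by (simp add: mult.assoc)
  moreover have "0 \<le> cmod (ell2_nth x i) * cmod (ell2_nth y i)"
    by simp
  ultimately have "cmod (ell2_nth x i) * cmod (ell2_nth y i) \<le> (cmod (ell2_nth x i))\<^sup>2 + (cmod (ell2_nth y i))\<^sup>2"
    by linarith
  then show "norm (norm (ell2_nth x i * cnj (ell2_nth y i))) \<le> (cmod (ell2_nth x i))\<^sup>2 + (cmod (ell2_nth y i))\<^sup>2"
    by (simp only: norm_mult complex_mod_cnj real_norm_def abs_mult abs_norm_cancel)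
qed

lemmas summable_cinner = summable_norm_cancel[OF summable_cinner_norm]

lemma cinner_ell2_self: "cinner_ell2 x x = complex_of_real ((norm x)\<^sup>2)"
  unfolding cinner_ell2_def norm_ell2_sq
  by (simp add: complex_norm_square[symmetric] suminf_of_real[OF ell2_summable] flip: of_real_power)

lemma cinner_ell2_Cauchy_Schwarz: "cmod (cinner_ell2 x y) \<le> norm x * norm y"
proof -
  have "cmod (cinner_ell2 x y) \<le> (\<Sum>i. norm (ell2_nth x i * cnj (ell2_nth y i)))"
    unfolding cinner_ell2_def by (rule summable_norm[OF summable_cinner_norm])
  also have "\<dots> \<le> norm x * norm y"
  proof (rule suminf_le_const[OF summable_cinner_norm])
    fix n
    have "(\<Sum>i<n. norm (ell2_nth x i * cnj (ell2_nth y i)))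
        \<le> L2_set (\<lambda>i. cmod (ell2_nth x i)) {..<n} * L2_set (\<lambda>i. cmod (ell2_nth y i)) {..<n}"
      using L2_set_mult_ineq[of "\<lambda>i. cmod (ell2_nth x i)" "\<lambda>i. cmod (ell2_nth y i)" "{..<n}"]
      by (simp add: norm_mult)
    also have "\<dots> \<le> norm x * norm y"
      by (intro mult_mono L2_set_le_norm_ell2) auto
    finally show "(\<Sum>i<n. norm (ell2_nth x i * cnj (ell2_nth y i))) \<le> norm x * norm y" .
  qed
  finally show ?thesis .
qed

lemma bounded_bilinear_cinner_ell2: "bounded_bilinear cinner_ell2"
proof
  fix x x' y y' :: ell2 and r :: real
  show "cinner_ell2 (x + x') y = cinner_ell2 x y + cinner_ell2 x' y"
    by (simp add: cinner_ell2_def distrib_right suminf_add[OF summable_cinner summable_cinner])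
  show "cinner_ell2 x (y + y') = cinner_ell2 x y + cinner_ell2 x y'"
    by (simp add: cinner_ell2_def distrib_left suminf_add[OF summable_cinner summable_cinner])
  show "cinner_ell2 (r *\<^sub>R x) y = r *\<^sub>R cinner_ell2 x y"
    by (simp add: cinner_ell2_def scaleR_conv_of_real mult.assoc suminf_mult[OF summable_cinner])
  show "cinner_ell2 x (r *\<^sub>R y) = r *\<^sub>R cinner_ell2 x y"
    by (simp add: cinner_ell2_def scaleR_conv_of_real mult.left_commute suminf_mult[OF summable_cinner])
  show "\<exists>K. \<forall>x y. norm (cinner_ell2 x y) \<le> norm x * norm y * K"
    using cinner_ell2_Cauchy_Schwarz by (intro exI[of _ 1]) simp
qed

lemma cinner_basis_ell2: "cinner_ell2 x (basis_ell2 i) = ell2_nth x i"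
proof -
  have "cinner_ell2 x (basis_ell2 i) = (\<Sum>j\<in>{i}. ell2_nth x j * cnj (ell2_nth (basis_ell2 i) j))"
    unfolding cinner_ell2_def by (rule suminf_finite) auto
  then show ?thesis by simp
qed

text \<open>
  Completeness is used twice: to form the limit of the operators, and to invert a small perturbation
  of an invertible operator.
\<close>

instance ell2 :: banach
proof
  fix X :: "nat \<Rightarrow> ell2"
  assume X: "Cauchy X"
  have "convergent (\<lambda>n. ell2_nth (X n) i)" for i
  proof -
    have "Cauchy (\<lambda>n. ell2_nth (X n) i)"
    proof (rule metric_CauchyI)
      fix e :: real assume "0 < e"
      then obtain M where M: "\<And>m n. m \<ge> M \<Longrightarrow> n \<ge> M \<Longrightarrow> dist (X m) (X n) < e"
        using X by (meson metric_CauchyD)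
      show "\<exists>M. \<forall>m\<ge>M. \<forall>n\<ge>M. dist (ell2_nth (X m) i) (ell2_nth (X n) i) < e"
      proof (intro exI allI impI)
        fix m n assume "m \<ge> M" "n \<ge> M"
        have "dist (ell2_nth (X m) i) (ell2_nth (X n) i) \<le> dist (X m) (X n)"
          using cmod_ell2_nth_le[of "X m - X n" i] by (simp add: dist_norm)
        then show "dist (ell2_nth (X m) i) (ell2_nth (X n) i) < e"
          using M[OF \<open>m \<ge> M\<close> \<open>n \<ge> M\<close>] by linarith
      qed
    qed
    then show ?thesis
      by (rule Cauchy_convergent)
  qed
  then obtain a where a: "\<And>i. (\<lambda>n. ell2_nth (X n) i) \<longlonglongrightarrow> a i"
    unfolding convergent_def by metis
  have partial: "(\<Sum>i<k. (cmod (ell2_nth (X m) i - a i))\<^sup>2) \<le> e\<^sup>2"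
    if "\<And>n. n \<ge> M \<Longrightarrow> norm (X m - X n) \<le> e" for m M k e
  proof (rule tendsto_upperbound)
    show "(\<lambda>n. \<Sum>i<k. (cmod (ell2_nth (X m) i - ell2_nth (X n) i))\<^sup>2)
        \<longlonglongrightarrow> (\<Sum>i<k. (cmod (ell2_nth (X m) i - a i))\<^sup>2)"
      by (intro tendsto_intros a)
    show "\<forall>\<^sub>F n in sequentially. (\<Sum>i<k. (cmod (ell2_nth (X m) i - ell2_nth (X n) i))\<^sup>2) \<le> e\<^sup>2"
      unfolding eventually_sequentially
      using norm_ell2_le_iff[of "X m - X _" e] that by auto
  qed simp
  obtain M where M: "\<And>m n. m \<ge> M \<Longrightarrow> n \<ge> M \<Longrightarrow> dist (X m) (X n) < 1"
    using X by (metis metric_CauchyD zero_less_one)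
  have "summable (\<lambda>i. (cmod (ell2_nth (X M) i - a i))\<^sup>2)"
  proof (rule bounded_imp_summable)
    fix k
    show "(\<Sum>i\<le>k. (cmod (ell2_nth (X M) i - a i))\<^sup>2) \<le> 1\<^sup>2"
      unfolding lessThan_Suc_atMost[symmetric]
      by (rule partial[of M]) (use M[of M] in \<open>simp add: dist_norm less_imp_le\<close>)
  qed simp
  then have "summable (\<lambda>i. (cmod (ell2_nth (X M) i + - (ell2_nth (X M) i - a i)))\<^sup>2)"
    by (intro square_summable_add ell2_summable) (simp add: norm_minus_commute)
  then have summ: "summable (\<lambda>i. (cmod (a i))\<^sup>2)"
    by simp
  define L where "L = Abs_ell2 a"
  have L: "ell2_nth L i = a i" for i
    using summ by (simp add: L_def Abs_ell2_inverse)
  have "X \<longlonglongrightarrow> L"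
  proof (rule metric_LIMSEQ_I)
    fix e :: real assume "0 < e"
    then obtain M where M: "\<And>m n. m \<ge> M \<Longrightarrow> n \<ge> M \<Longrightarrow> dist (X m) (X n) < e / 2"
      using X by (meson metric_CauchyD half_gt_zero)
    have "dist (X m) L < e" if "m \<ge> M" for m
    proof -
      have "\<forall>k. (\<Sum>i<k. (cmod (ell2_nth (X m - L) i))\<^sup>2) \<le> (e / 2)\<^sup>2"
        using partial[of M m "e / 2"] M[OF that] by (simp add: L dist_norm less_imp_le)
      then have "norm (X m - L) \<le> e / 2"
        unfolding norm_ell2_le_iff using \<open>0 < e\<close> by simp
      then show ?thesis
        using \<open>0 < e\<close> by (simp add: dist_norm)
    qed
    then show "\<exists>M. \<forall>m\<ge>M. dist (X m) L < e" by blast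
  qed
  then show "convergent X"
    by (rule convergentI)
qed

section \<open>Operators given by a finite block and a diagonal\<close>

text \<open>
  The direct sum of an \<open>n\<close> by \<open>n\<close> matrix and an infinite diagonal matrix. The stages, their
  differences and the orthogonal matrices that diagonalise them are all of this form. For unbounded
  \<open>d\<close> the sequence need not be square-summable and the value is unspecified.
\<close>

definition block_op :: "nat \<Rightarrow> (nat \<Rightarrow> nat \<Rightarrow> complex) \<Rightarrow> (nat \<Rightarrow> complex) \<Rightarrow> ell2 \<Rightarrow> ell2" where
  "block_op n K d x =
    Abs_ell2 (\<lambda>i. if i < n then (\<Sum>j<n. K i j * ell2_nth x j) else d i * ell2_nth x i)"

lemma ell2_nth_block_op:
  assumes "bounded (range d)"
  shows "ell2_nth (block_op n K d x) i =
    (if i < n then (\<Sum>j<n. K i j * ell2_nth x j) else d i * ell2_nth x i)"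
proof -
  obtain b where b: "\<And>i. cmod (d i) \<le> b"
    using assms by (auto simp: bounded_iff)
  let ?f = "\<lambda>i. if i < n then (\<Sum>j<n. K i j * ell2_nth x j) else d i * ell2_nth x i"
  have "summable (\<lambda>i. (cmod (?f i))\<^sup>2)"
  proof (rule summable_comparison_test'[where N = n])
    show "summable (\<lambda>i. b\<^sup>2 * (cmod (ell2_nth x i))\<^sup>2)"
      by (intro summable_mult ell2_summable)
    fix i assume "n \<le> i"
    then show "norm ((cmod (?f i))\<^sup>2) \<le> b\<^sup>2 * (cmod (ell2_nth x i))\<^sup>2"
      using b[of i] by (simp add: norm_mult power_mult_distrib mult_right_mono power_mono)
  qed
  then show ?thesis
    by (simp add: block_op_def Abs_ell2_inverse)
qed

lemma norm_ell2_le_scaled: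
  assumes "\<And>i. cmod (ell2_nth y i) \<le> b * cmod (ell2_nth x i)" and "0 \<le> b"
  shows "norm y \<le> b * norm x"
proof -
  have "(norm y)\<^sup>2 \<le> (\<Sum>i. b\<^sup>2 * (cmod (ell2_nth x i))\<^sup>2)"
    unfolding norm_ell2_sq
  proof (rule suminf_le)
    show "(cmod (ell2_nth y i))\<^sup>2 \<le> b\<^sup>2 * (cmod (ell2_nth x i))\<^sup>2" for i
      using power_mono[OF assms(1)] by (simp add: power_mult_distrib)
  qed (intro summable_mult ell2_summable)+
  also have "\<dots> = (b * norm x)\<^sup>2"
    by (simp add: suminf_mult[OF ell2_summable] norm_ell2_sq[symmetric] power_mult_distrib)
  finally show ?thesis
    by (rule power2_le_imp_le) (use assms(2) in simp)
qed

lemma norm_ell2_finite_support: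
  assumes "\<And>i. n \<le> i \<Longrightarrow> ell2_nth y i = 0"
  shows "norm y \<le> (\<Sum>i<n. cmod (ell2_nth y i))"
proof -
  have "norm y = L2_set (\<lambda>i. cmod (ell2_nth y i)) {..<n}"
    unfolding norm_ell2_def L2_set_def by (subst suminf_finite[of "{..<n}"]) (use assms in auto)
  also have "\<dots> \<le> (\<Sum>i<n. cmod (ell2_nth y i))"
    by (rule L2_set_le_sum) simp
  finally show ?thesis .
qed

text \<open>
  Crude, but the weights of new edges are at free disposal, so any bound in terms of the entries
  serves to make consecutive stages close.
\<close>

lemma norm_block_op_zero_le:
  "norm (block_op n K (\<lambda>_. 0) x) \<le> (\<Sum>i<n. \<Sum>j<n. cmod (K i j)) * norm x"
proof -
  have nth: "ell2_nth (block_op n K (\<lambda>_. 0) x) i = (if i < n then (\<Sum>j<n. K i j * ell2_nth x j) else 0)" for i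
    by (subst ell2_nth_block_op) auto
  have "norm (block_op n K (\<lambda>_. 0) x) \<le> (\<Sum>i<n. cmod (\<Sum>j<n. K i j * ell2_nth x j))"
    using norm_ell2_finite_support[of n "block_op n K (\<lambda>_. 0) x"] by (simp add: nth)
  also have "\<dots> \<le> (\<Sum>i<n. \<Sum>j<n. cmod (K i j) * norm x)"
    by (intro sum_mono order_trans[OF norm_sum])
      (simp add: norm_mult mult_left_mono cmod_ell2_nth_le)
  finally show ?thesis
    by (simp add: sum_distrib_right)
qed

lemma norm_block_op_zero_uniform_le:
  assumes "\<And>i j. i < n \<Longrightarrow> j < n \<Longrightarrow> cmod (K i j) \<le> b"
  shows "norm (block_op n K (\<lambda>_. 0) x) \<le> real n * real n * b * norm x"
proof -
  have "(\<Sum>i<n. \<Sum>j<n. cmod (K i j)) \<le> (\<Sum>i<n. \<Sum>j<n. b)"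
    using assms by (intro sum_mono) auto
  then have "(\<Sum>i<n. \<Sum>j<n. cmod (K i j)) \<le> real n * real n * b"
    by simp
  then show ?thesis
    using order_trans[OF norm_block_op_zero_le mult_right_mono[OF _ norm_ge_zero]] by blast
qed

lemma block_op_minus:
  assumes "bounded (range d)"
  shows "block_op n K d x - block_op n L d x = block_op n (\<lambda>i j. K i j - L i j) (\<lambda>_. 0) x"
proof (rule ell2_eqI)
  have 0: "bounded (range (\<lambda>_::nat. 0::complex))" by simp
  show "ell2_nth (block_op n K d x - block_op n L d x) i
      = ell2_nth (block_op n (\<lambda>i j. K i j - L i j) (\<lambda>_. 0) x) i" for i
    by (simp add: ell2_nth_block_op[OF assms] ell2_nth_block_op[OF 0] left_diff_distrib sum_subtractf)
qed

lemma bounded_operator_block_op: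
  assumes d: "bounded (range d)"
  shows "bounded_operator (block_op n K d)"
proof -
  obtain b where b: "\<And>i. cmod (d i) \<le> b" "0 \<le> b"
    using d by (auto simp: bounded_pos)  (metis less_imp_le)
  define B where "B = (\<Sum>i<n. \<Sum>j<n. cmod (K i j))"
  have 0: "bounded (range (\<lambda>_::nat. 0::complex))" by simp
  have "bounded_linear (block_op n K d)"
  proof (rule bounded_linear_intro)
    fix x y :: ell2 and r :: real
    show "block_op n K d (x + y) = block_op n K d x + block_op n K d y"
      by (rule ell2_eqI) (simp add: ell2_nth_block_op[OF d] distrib_left sum.distrib)
    show "block_op n K d (r *\<^sub>R x) = r *\<^sub>R block_op n K d x"
      by (rule ell2_eqI) (simp add: ell2_nth_block_op[OF d] mult.left_commute sum_distrib_left)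
    have "norm (block_op n (\<lambda>_ _. 0) d x) \<le> b * norm x"
      by (rule norm_ell2_le_scaled)
        (use b in \<open>simp_all add: ell2_nth_block_op[OF d] norm_mult mult_right_mono\<close>)
    moreover have "block_op n K d x = block_op n (\<lambda>_ _. 0) d x + block_op n K (\<lambda>_. 0) x"
      by (rule ell2_eqI) (simp add: ell2_nth_block_op[OF d] ell2_nth_block_op[OF 0])
    moreover have "norm (block_op n K (\<lambda>_. 0) x) \<le> B * norm x"
      unfolding B_def by (rule norm_block_op_zero_le)
    ultimately show "norm (block_op n K d x) \<le> norm x * (b + B)"
      using norm_triangle_ineq[of "block_op n (\<lambda>_ _. 0) d x" "block_op n K (\<lambda>_. 0) x"]
      by (simp add: distrib_left mult.commute)
  qed
  moreover have "block_op n K d (c *\<^sub>C x) = c *\<^sub>C block_op n K d x" for c x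
    by (rule ell2_eqI) (simp add: ell2_nth_block_op[OF d] mult.left_commute sum_distrib_left)
  ultimately show ?thesis
    by (simp add: bounded_operator_def)
qed

lemma block_op_adjoint:
  assumes d: "bounded (range d)"
  shows "cinner_ell2 (block_op n K d x) y
    = cinner_ell2 x (block_op n (\<lambda>i j. cnj (K j i)) (\<lambda>i. cnj (d i)) y)"
proof -
  have d': "bounded (range (\<lambda>i. cnj (d i)))"
    using d by (auto simp: bounded_iff)
  let ?L = "block_op n K d x" and ?R = "block_op n (\<lambda>i j. cnj (K j i)) (\<lambda>i. cnj (d i)) y"
  have "(\<Sum>i<n. (\<Sum>j<n. K i j * ell2_nth x j) * cnj (ell2_nth y i))
      = (\<Sum>j<n. ell2_nth x j * cnj (\<Sum>i<n. cnj (K i j) * ell2_nth y i))"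
    unfolding sum_distrib_right cnj_sum sum_distrib_left by (subst sum.swap) (simp add: mult_ac)
  then have "(\<Sum>i<n. ell2_nth ?L i * cnj (ell2_nth y i)) = (\<Sum>i<n. ell2_nth x i * cnj (ell2_nth ?R i))"
    by (simp add: ell2_nth_block_op[OF d] ell2_nth_block_op[OF d'])
  moreover have "ell2_nth ?L (i + n) * cnj (ell2_nth y (i + n)) = ell2_nth x (i + n) * cnj (ell2_nth ?R (i + n))" for i
    by (simp add: ell2_nth_block_op[OF d] ell2_nth_block_op[OF d'] mult_ac)
  ultimately show ?thesis
    unfolding cinner_ell2_def
      suminf_split_initial_segment[OF summable_cinner[of ?L y], of n]
      suminf_split_initial_segment[OF summable_cinner[of x ?R], of n]
    by simp
qed

lemma bounded_linear_ell2_nth: "bounded_linear (\<lambda>x. ell2_nth x i)"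
  by (rule bounded_linear_intro[where K = 1]) (simp_all add: cmod_ell2_nth_le scaleR_conv_of_real)

lemma bounded_linear_scale_ell2: "bounded_linear (\<lambda>x. c *\<^sub>C x)"
proof (rule bounded_linear_intro[where K = "cmod c"])
  show "c *\<^sub>C (x + y) = c *\<^sub>C x + c *\<^sub>C y" for x y
    by (rule ell2_eqI) (simp add: distrib_left)
  show "c *\<^sub>C (r *\<^sub>R x) = r *\<^sub>R (c *\<^sub>C x)" for r x
    by (rule ell2_eqI) (simp add: mult.left_commute)
qed (simp add: norm_scale_ell2 mult.commute)

lemma bounded_operator_diff_scale:
  assumes "bounded_operator T"
  shows "bounded_operator (\<lambda>x. T x - z *\<^sub>C x)"
  unfolding bounded_operator_def
proof (intro conjI allI)
  show "bounded_linear (\<lambda>x. T x - z *\<^sub>C x)"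
    using assms by (intro bounded_linear_sub bounded_linear_scale_ell2) (simp add: bounded_operator_def)
  show "T (c *\<^sub>C x) - z *\<^sub>C c *\<^sub>C x = c *\<^sub>C (T x - z *\<^sub>C x)" for c x
  proof -
    have "T (c *\<^sub>C x) = c *\<^sub>C T x" using assms by (simp add: bounded_operator_def)
    then show ?thesis
      by (intro ell2_eqI) (simp add: right_diff_distrib mult.left_commute)
  qed
qed

section \<open>Perturbation of invertible operators\<close>

text \<open>
  To solve \<open>A x = y\<close>, rewrite it as the fixed point equation \<open>x = S (y - (A x - B x))\<close>, whose right-hand
  side contracts by the factor \<open>c * e\<close>. The same estimate bounds \<open>A\<close> from below, which gives injectivity and the
  boundedness of the inverse.
\<close>

lemma invertible_operator_perturbation:
  assumes A: "bounded_operator A"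
    and SB: "\<And>x. S (B x) = x" and BS: "\<And>x. B (S x) = x"
    and S: "bounded_linear S" "\<And>x. norm (S x) \<le> c * norm x" "0 \<le> c"
    and AB: "\<And>x. norm (A x - B x) \<le> e * norm x" "bounded_linear B" and "0 \<le> e" "c * e < 1"
  shows "invertible_operator A"
proof -
  interpret A: bounded_linear A using A by (simp add: bounded_operator_def)
  interpret S: bounded_linear S by fact
  interpret B: bounded_linear B by fact
  have surj: "\<exists>x. A x = y" for y
  proof -
    have "\<exists>!x. S (y - (A x - B x)) = x"
    proof (rule banach_fix_type)
      show "0 \<le> c * e" "c * e < 1" using assms by auto
      show "\<forall>u v. dist (S (y - (A u - B u))) (S (y - (A v - B v))) \<le> c * e * dist u v"
      proof (intro allI)
        fix u v
        have "dist (S (y - (A u - B u))) (S (y - (A v - B v))) = norm (S (A (v - u) - B (v - u)))"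
          by (simp add: dist_norm S.diff[symmetric] A.diff B.diff algebra_simps)
        also have "\<dots> \<le> c * norm (A (v - u) - B (v - u))"
          by (rule S(2))
        also have "\<dots> \<le> c * (e * norm (v - u))"
          using AB(1) S(3) by (rule mult_left_mono)
        finally show "dist (S (y - (A u - B u))) (S (y - (A v - B v))) \<le> c * e * dist u v"
          by (simp add: dist_norm norm_minus_commute mult.assoc)
      qed
    qed
    then obtain x where "S (y - (A x - B x)) = x" by blast
    then have "y - (A x - B x) = B x" using BS by metis
    then have "A x = y" by (simp add: algebra_simps)
    then show ?thesis ..
  qed
  have below: "norm x \<le> c / (1 - c * e) * norm (A x)" for x
  proof -
    have "norm x = norm (S (A x) - S (A x - B x))"
      by (simp add: S.diff[symmetric] SB)
    also have "\<dots> \<le> norm (S (A x)) + norm (S (A x - B x))"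
      by (rule norm_triangle_ineq4)
    also have "\<dots> \<le> c * norm (A x) + c * (e * norm x)"
      using S(2)[of "A x"] S(2)[of "A x - B x"] mult_left_mono[OF AB(1) S(3), of x] by linarith
    finally show ?thesis
      using \<open>c * e < 1\<close> by (simp add: field_simps)
  qed
  have inj: "x = y" if "A x = A y" for x y
    using below[of "x - y"] that by (simp add: A.diff)
  define R where "R = inv A"
  have AR: "A (R y) = y" for y
    using surj by (simp add: R_def surj_def surj_f_inv_f) (metis f_inv_into_f rangeI)
  have RA: "R (A x) = x" for x
    using AR inj by blast
  have "bounded_operator R"
    unfolding bounded_operator_def
  proof (intro conjI allI)
    show "bounded_linear R"
    proof (rule bounded_linear_intro)
      show "R (x + y) = R x + R y" for x y
        by (rule inj) (simp add: AR A.add)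
      show "R (r *\<^sub>R x) = r *\<^sub>R R x" for r x
        by (rule inj) (simp add: AR A.scaleR)
      show "norm (R x) \<le> norm x * (c / (1 - c * e))" for x
        using below[of "R x"] by (simp add: AR mult.commute)
    qed
    show "R (a *\<^sub>C x) = a *\<^sub>C R x" for a x
    proof (rule inj)
      have "A (a *\<^sub>C R x) = a *\<^sub>C A (R x)" using A by (simp add: bounded_operator_def)
      then show "A (R (a *\<^sub>C x)) = A (a *\<^sub>C R x)" by (simp add: AR)
    qed
  qed
  then show ?thesis
    unfolding invertible_operator_def using AR RA by (intro exI[of _ R]) (auto simp: fun_eq_iff)
qed

text \<open>
  A bounded inverse of \<open>T - z\<close> would send the null sequence \<open>T (x n) - z *\<^sub>C x n\<close> back to the unit
  vectors \<open>x n\<close>, which do not tend to 0.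
\<close>

lemma approx_point_spectrum_subset: "approx_point_spectrum T \<subseteq> op_spectrum T"
proof
  fix z assume "z \<in> approx_point_spectrum T"
  then obtain x where x: "\<And>n. norm (x n) = 1" "(\<lambda>n. T (x n) - z *\<^sub>C x n) \<longlonglongrightarrow> 0"
    by (auto simp: approx_point_spectrum_def)
  show "z \<in> op_spectrum T"
  proof (rule ccontr)
    assume "z \<notin> op_spectrum T"
    then obtain S where S: "bounded_linear S" "\<And>y. S (T y - z *\<^sub>C y) = y"
      by (auto simp: op_spectrum_def invertible_operator_def bounded_operator_def fun_eq_iff)
    have "(\<lambda>n. S (T (x n) - z *\<^sub>C x n)) \<longlonglongrightarrow> S 0"
      using S(1) x(2) by (rule bounded_linear.tendsto)
    then have "x \<longlonglongrightarrow> 0"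
      using S by (simp add: linear_simps)
    then have "(\<lambda>n. norm (x n)) \<longlonglongrightarrow> 0"
      by (rule tendsto_norm_zero)
    then show False
      using x(1) by (simp add: LIMSEQ_const_iff)
  qed
qed

section \<open>Rotations in the first coordinates\<close>

definition real_block_op :: "nat \<Rightarrow> (nat \<Rightarrow> nat \<Rightarrow> real) \<Rightarrow> (nat \<Rightarrow> real) \<Rightarrow> ell2 \<Rightarrow> ell2" where
  "real_block_op n A d = block_op n (\<lambda>i j. complex_of_real (A i j)) (\<lambda>i. complex_of_real (d i))"

abbreviation rotation_op :: "nat \<Rightarrow> (nat \<Rightarrow> nat \<Rightarrow> real) \<Rightarrow> ell2 \<Rightarrow> ell2" where
  "rotation_op n Q \<equiv> real_block_op n Q (\<lambda>_. 1)"

definition diag_op :: "(nat \<Rightarrow> complex) \<Rightarrow> ell2 \<Rightarrow> ell2" where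
  "diag_op d = block_op 0 (\<lambda>_ _. 0) d"

lemma bounded_range_of_real: "bounded (range d) \<Longrightarrow> bounded (range (\<lambda>i. complex_of_real (d i)))"
  by (auto simp: bounded_iff)

lemma ell2_nth_diag_op: "bounded (range d) \<Longrightarrow> ell2_nth (diag_op d x) i = d i * ell2_nth x i"
  by (simp add: diag_op_def ell2_nth_block_op)

lemma ell2_nth_real_block_op:
  assumes "bounded (range d)"
  shows "ell2_nth (real_block_op n A d x) i =
    (if i < n then (\<Sum>j<n. complex_of_real (A i j) * ell2_nth x j) else complex_of_real (d i) * ell2_nth x i)"
  unfolding real_block_op_def by (rule ell2_nth_block_op[OF bounded_range_of_real[OF assms]])

lemma bounded_operator_real_block_op:
  "bounded (range d) \<Longrightarrow> bounded_operator (real_block_op n A d)"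
  unfolding real_block_op_def by (intro bounded_operator_block_op bounded_range_of_real)

lemma bounded_linear_real_block_op:
  "bounded (range d) \<Longrightarrow> bounded_linear (real_block_op n A d)"
  using bounded_operator_real_block_op by (simp add: bounded_operator_def)

lemma bounded_range_const: "bounded (range (\<lambda>_::nat. c::real))"
  by simp

lemmas rotation_linear = bounded_linear_real_block_op[OF bounded_range_const]

lemma rotation_scale: "rotation_op n Q (c *\<^sub>C x) = c *\<^sub>C rotation_op n Q x"
  using bounded_operator_real_block_op[OF bounded_range_const] by (simp add: bounded_operator_def)

lemma real_block_op_adjoint:
  assumes "bounded (range d)"
  shows "cinner_ell2 (real_block_op n A d x) y = cinner_ell2 x (real_block_op n (\<lambda>i j. A j i) d y)"
  using block_op_adjoint[OF bounded_range_of_real[OF assms]] by (simp add: real_block_op_def)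

lemma rotation_inverse:
  assumes Q: "orthonormal_columns n Q"
  shows "rotation_op n (\<lambda>i k. Q k i) (rotation_op n Q x) = x"
proof (rule ell2_eqI)
  fix i
  have "(\<Sum>m<n. complex_of_real (Q m i) * (\<Sum>j<n. complex_of_real (Q m j) * ell2_nth x j)) = ell2_nth x i"
    if "i < n"
  proof -
    have delta: "(\<Sum>m<n. complex_of_real (Q m i) * complex_of_real (Q m j)) = (if i = j then 1 else 0)"
      if "j < n" for j
    proof -
      have "(\<Sum>m<n. Q m i * Q m j) = (if i = j then 1 else 0)"
        using Q \<open>i < n\<close> that by (simp add: orthonormal_columns_def)
      then have "complex_of_real (\<Sum>m<n. Q m i * Q m j) = (if i = j then 1 else 0)"
        by simp
      then show ?thesis by simp
    qed
    have "(\<Sum>m<n. complex_of_real (Q m i) * (\<Sum>j<n. complex_of_real (Q m j) * ell2_nth x j))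
        = (\<Sum>j<n. (\<Sum>m<n. complex_of_real (Q m i) * complex_of_real (Q m j)) * ell2_nth x j)"
      unfolding sum_distrib_left sum_distrib_right by (subst sum.swap) (simp add: mult.assoc)
    also have "\<dots> = (\<Sum>j<n. (if i = j then 1 else 0) * ell2_nth x j)"
      by (intro sum.cong refl) (simp only: delta lessThan_iff)
    finally show ?thesis
      using that by (simp only: sum_kronecker)
  qed
  then show "ell2_nth (rotation_op n (\<lambda>i k. Q k i) (rotation_op n Q x)) i = ell2_nth x i"
    by (simp add: ell2_nth_real_block_op)
qed

text \<open>
  The adjoint of a rotation is its inverse.
\<close>

lemma norm_rotation:
  assumes Q: "orthonormal_columns n Q"
  shows "norm (rotation_op n Q x) = norm x"
proof -
  have "cinner_ell2 (rotation_op n Q x) (rotation_op n Q x) = cinner_ell2 x x"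
    by (simp only: real_block_op_adjoint[OF bounded_range_const] rotation_inverse[OF Q])
  then have "(norm (rotation_op n Q x))\<^sup>2 = (norm x)\<^sup>2"
    unfolding cinner_ell2_self of_real_eq_iff .
  then show ?thesis
    by (rule power2_eq_imp_eq) auto
qed

lemma real_block_op_rotation:
  assumes D: "diagonalises n \<mu> A Q" and \<mu>: "bounded (range \<mu>)"
  shows "real_block_op n A \<mu> (rotation_op n Q x) = rotation_op n Q (diag_op (\<lambda>i. complex_of_real (\<mu> i)) x)"
proof (rule ell2_eqI)
  fix i
  have "(\<Sum>j<n. complex_of_real (A i j) * (\<Sum>k<n. complex_of_real (Q j k) * ell2_nth x k))
      = (\<Sum>k<n. complex_of_real (Q i k) * (complex_of_real (\<mu> k) * ell2_nth x k))" if "i < n"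
  proof -
    have "(\<Sum>j<n. complex_of_real (A i j) * (\<Sum>k<n. complex_of_real (Q j k) * ell2_nth x k))
        = (\<Sum>k<n. (\<Sum>j<n. complex_of_real (A i j) * complex_of_real (Q j k)) * ell2_nth x k)"
      unfolding sum_distrib_left sum_distrib_right by (subst sum.swap) (simp add: mult.assoc)
    also have "\<dots> = (\<Sum>k<n. complex_of_real (\<mu> k * Q i k) * ell2_nth x k)"
    proof (rule sum.cong[OF refl])
      fix k assume "k \<in> {..<n}"
      then have "(\<Sum>j<n. A i j * Q j k) = \<mu> k * Q i k"
        using D \<open>i < n\<close> decomposition_imp_eigenvector[of n Q A \<mu> i k] by (simp add: diagonalises_def)
      then have "complex_of_real (\<Sum>j<n. A i j * Q j k) = complex_of_real (\<mu> k * Q i k)"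
        by (rule arg_cong)
      then show "(\<Sum>j<n. complex_of_real (A i j) * complex_of_real (Q j k)) * ell2_nth x k
          = complex_of_real (\<mu> k * Q i k) * ell2_nth x k"
        by simp
    qed
    finally show ?thesis
      by (simp add: mult_ac)
  qed
  then show "ell2_nth (real_block_op n A \<mu> (rotation_op n Q x)) i
      = ell2_nth (rotation_op n Q (diag_op (\<lambda>i. complex_of_real (\<mu> i)) x)) i"
    by (simp add: ell2_nth_real_block_op \<mu> ell2_nth_diag_op bounded_range_of_real)
qed

lemma real_block_op_Suc:
  assumes "bounded (range \<mu>)"
  shows "real_block_op n A \<mu> x = real_block_op (Suc n) (pad n \<mu> A) \<mu> x"
  by (rule ell2_eqI) (auto simp: ell2_nth_real_block_op[OF assms] less_Suc_eq)

section \<open>The spectrum of a norm limit\<close>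

text \<open>
  For \<open>z\<close> outside \<open>\<Lambda>\<close> every stage minus \<open>z\<close> has the inverse \<open>U D U\<^sup>T\<close> with a rotation \<open>U\<close> and \<open>D\<close> diagonal with
  entries \<open>1 / (\<mu> i - z)\<close>. Its norm is at most \<open>1 / d\<close>, where \<open>d\<close> is the distance of \<open>z\<close> to \<open>\<Lambda>\<close>, whatever
  the stage. A stage that is closer than \<open>d\<close> to \<open>T\<close> therefore forces \<open>T - z\<close> to be invertible.
\<close>

lemma op_spectrum_limit_subset:
  assumes T: "bounded_operator T" and \<mu>: "bounded (range \<mu>)"
    and diag: "\<And>n. diagonalises n \<mu> (A n) (Q n)"
    and approx: "\<And>n x. norm (T x - real_block_op n (A n) \<mu> x) \<le> e n * norm x"
    and e: "\<And>n. 0 \<le> e n" "e \<longlonglongrightarrow> 0"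
    and \<Lambda>: "compact \<Lambda>" "range \<mu> \<subseteq> \<Lambda>"
  shows "op_spectrum T \<subseteq> complex_of_real ` \<Lambda>"
proof (rule subsetI, rule ccontr)
  fix z assume "z \<in> op_spectrum T" and z: "z \<notin> complex_of_real ` \<Lambda>"
  have "closed (complex_of_real ` \<Lambda>)"
    using \<Lambda>(1) by (intro compact_imp_closed compact_continuous_image continuous_intros)
  then obtain d where "0 < d" and d: "\<And>w. w \<in> complex_of_real ` \<Lambda> \<Longrightarrow> d \<le> dist z w"
    using separate_point_closed z by metis
  define r where "r i = 1 / (complex_of_real (\<mu> i) - z)" for i
  have gap: "d \<le> cmod (complex_of_real (\<mu> i) - z)" for i
    using d[of "complex_of_real (\<mu> i)"] \<Lambda>(2) by (auto simp: dist_norm norm_minus_commute)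
  then have r_le: "cmod (r i) \<le> 1 / d" for i
    unfolding r_def norm_divide using \<open>0 < d\<close> by (intro frac_le) auto
  then have r: "bounded (range r)" by (auto simp: bounded_iff)
  have r_inv: "(complex_of_real (\<mu> i) - z) * r i = 1" for i
    using gap[of i] \<open>0 < d\<close> by (auto simp: r_def)
  obtain n where "e n < d"
    using order_tendstoD(2)[OF e(2) \<open>0 < d\<close>] by (auto simp: eventually_sequentially)
  define U where "U = rotation_op n (Q n)"
  define V where "V = rotation_op n (\<lambda>i k. Q n k i)"
  have Q: "orthonormal_columns n (Q n)" using diag by (simp add: diagonalises_def)
  have VU: "V (U x) = x" for x
    using rotation_inverse[OF Q] by (simp add: U_def V_def)
  have UV: "U (V x) = x" for x
    using rotation_inverse[OF orthonormal_columns_imp_rows[OF Q]] by (simp add: U_def V_def)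
  have U: "bounded_linear U" and V: "bounded_linear V"
    unfolding U_def V_def by (rule rotation_linear)+
  define B where "B x = real_block_op n (A n) \<mu> x - z *\<^sub>C x" for x
  define D where "D x = diag_op (\<lambda>i. complex_of_real (\<mu> i)) x - z *\<^sub>C x" for x
  have BU: "B (U x) = U (D x)" for x
    unfolding B_def D_def U_def real_block_op_rotation[OF diag \<mu>]
    by (simp add: rotation_scale linear_simps[OF rotation_linear])
  have rD: "diag_op r (D x) = x" "D (diag_op r x) = x" for x
  proof -
    have "r i * (complex_of_real (\<mu> i) * a - z * a) = (complex_of_real (\<mu> i) - z) * r i * a"
      "complex_of_real (\<mu> i) * (r i * a) - z * (r i * a) = (complex_of_real (\<mu> i) - z) * r i * a" for i a
      by (simp_all add: left_diff_distrib right_diff_distrib mult_ac)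
    then show "diag_op r (D x) = x" "D (diag_op r x) = x"
      by (auto intro!: ell2_eqI simp: D_def ell2_nth_diag_op r \<mu> bounded_range_of_real r_inv)
  qed
  define S where "S y = U (diag_op r (V y))" for y
  have "invertible_operator (\<lambda>x. T x - z *\<^sub>C x)"
  proof (rule invertible_operator_perturbation[where S = S and B = B and c = "1 / d" and e = "e n"])
    show "bounded_operator (\<lambda>x. T x - z *\<^sub>C x)"
      by (rule bounded_operator_diff_scale[OF T])
    show "S (B x) = x" for x
    proof -
      have "B x = U (D (V x))" using BU[of "V x"] by (simp add: UV)
      then show ?thesis by (simp add: S_def VU rD UV)
    qed
    show "B (S x) = x" for x
      by (simp add: S_def BU rD UV)
    have "bounded_linear (diag_op r)"
      unfolding diag_op_def using bounded_operator_block_op[OF r] by (simp add: bounded_operator_def)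
    then show "bounded_linear S"
      unfolding S_def using bounded_linear_compose[OF U bounded_linear_compose[OF _ V]] by (simp add: o_def)
    show "norm (S x) \<le> 1 / d * norm x" for x
    proof -
      have "norm (S x) = norm (diag_op r (V x))"
        unfolding S_def U_def by (rule norm_rotation[OF Q])
      also have "\<dots> \<le> 1 / d * norm (V x)"
      proof (rule norm_ell2_le_scaled)
        show "cmod (ell2_nth (diag_op r (V x)) i) \<le> 1 / d * cmod (ell2_nth (V x) i)" for i
          unfolding ell2_nth_diag_op[OF r] norm_mult by (rule mult_right_mono[OF r_le]) simp
      qed (use \<open>0 < d\<close> in simp)
      also have "norm (V x) = norm x"
        unfolding V_def by (rule norm_rotation[OF orthonormal_columns_imp_rows[OF Q]])
      finally show ?thesis .
    qed
    show "bounded_linear B"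
      unfolding B_def by (intro bounded_linear_sub bounded_linear_real_block_op \<mu> bounded_linear_scale_ell2)
    show "norm (T x - z *\<^sub>C x - B x) \<le> e n * norm x" for x
      using approx[of x n] by (simp add: B_def)
    show "0 \<le> 1 / d" "0 \<le> e n" "1 / d * e n < 1"
      using \<open>0 < d\<close> e(1) \<open>e n < d\<close> by (auto simp: field_simps)
  qed
  then show False
    using \<open>z \<in> op_spectrum T\<close> by (simp add: op_spectrum_def)
qed

text \<open>
  The rotation of stage \<open>n\<close> maps the \<open>k\<close>-th basis vector to a unit eigenvector with eigenvalue \<open>\<mu> k\<close>, for every
  \<open>k\<close>, also for \<open>k \<ge> n\<close>. So \<open>k\<close> can be chosen at each stage with \<open>\<mu> k\<close> close to the given point.
\<close>

lemma closure_subset_approx_point_spectrum_limit: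
  assumes \<mu>: "bounded (range \<mu>)"
    and diag: "\<And>n. diagonalises n \<mu> (A n) (Q n)"
    and approx: "\<And>n x. norm (T x - real_block_op n (A n) \<mu> x) \<le> e n * norm x"
    and e: "e \<longlonglongrightarrow> 0"
  shows "complex_of_real ` closure (range \<mu>) \<subseteq> approx_point_spectrum T"
proof (rule image_subsetI)
  fix t assume t: "t \<in> closure (range \<mu>)"
  have "\<exists>k. dist (\<mu> k) t < 1 / Suc n" for n
    using t by (auto simp: closure_approachable)
  then obtain k where k: "\<And>n. dist (\<mu> (k n)) t < 1 / Suc n" by metis
  define u where "u n = rotation_op n (Q n) (basis_ell2 (k n))" for n
  have Q: "orthonormal_columns n (Q n)" for n using diag by (simp add: diagonalises_def)
  have norm_u: "norm (u n) = 1" for n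
    unfolding u_def by (simp add: norm_rotation[OF Q] norm_basis_ell2)
  have eig: "real_block_op n (A n) \<mu> (u n) = complex_of_real (\<mu> (k n)) *\<^sub>C u n" for n
  proof -
    have "diag_op (\<lambda>i. complex_of_real (\<mu> i)) (basis_ell2 (k n)) = complex_of_real (\<mu> (k n)) *\<^sub>C basis_ell2 (k n)"
      by (rule ell2_eqI) (simp add: ell2_nth_diag_op \<mu> bounded_range_of_real)
    then show ?thesis
      unfolding u_def real_block_op_rotation[OF diag \<mu>] by (simp only: rotation_scale)
  qed
  have "(\<lambda>n. T (u n) - complex_of_real t *\<^sub>C u n) \<longlonglongrightarrow> 0"
  proof (rule Lim_null_comparison)
    have "norm (T (u n) - complex_of_real t *\<^sub>C u n) \<le> e n + 1 / Suc n" for n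
    proof -
      have "T (u n) - complex_of_real t *\<^sub>C u n =
          (T (u n) - real_block_op n (A n) \<mu> (u n)) + complex_of_real (\<mu> (k n) - t) *\<^sub>C u n"
        unfolding eig by (rule ell2_eqI) (simp add: algebra_simps)
      also have "norm \<dots> \<le> norm (T (u n) - real_block_op n (A n) \<mu> (u n)) + norm (complex_of_real (\<mu> (k n) - t) *\<^sub>C u n)"
        by (rule norm_triangle_ineq)
      also have "norm (complex_of_real (\<mu> (k n) - t) *\<^sub>C u n) \<le> 1 / Suc n"
        using k[of n] by (simp add: norm_scale_ell2 norm_u dist_norm flip: of_real_diff)
      also have "norm (T (u n) - real_block_op n (A n) \<mu> (u n)) \<le> e n"
        using approx[of "u n" n] by (simp add: norm_u)
      finally show ?thesis by simp
    qed
    then show "\<forall>\<^sub>F n in sequentially. norm (T (u n) - complex_of_real t *\<^sub>C u n) \<le> e n + 1 / Suc n"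
      by simp
    show "(\<lambda>n. e n + 1 / Suc n) \<longlonglongrightarrow> 0"
      using tendsto_add[OF e LIMSEQ_Suc[OF lim_1_over_n[where 'a = real]]] by simp
  qed
  then show "complex_of_real t \<in> approx_point_spectrum T"
    unfolding approx_point_spectrum_def using norm_u by blast
qed

section \<open>Existence of the operator\<close>

lemma infinite_closed_imp_dense_injective_sequence:
  fixes \<Lambda> :: "real set"
  assumes "infinite \<Lambda>" "closed \<Lambda>"
  shows "\<exists>\<mu> :: nat \<Rightarrow> real. inj \<mu> \<and> closure (range \<mu>) = \<Lambda>"
proof -
  obtain D where D: "countable D" "D \<subseteq> \<Lambda>" "\<Lambda> \<subseteq> closure D"
    using separable by blast
  have "infinite D"
  proof
    assume "finite D"
    then have "\<Lambda> \<subseteq> D" using D(3) by (simp add: finite_imp_closed)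
    then show False using \<open>finite D\<close> assms(1) finite_subset by blast
  qed
  then have "bij_betw (from_nat_into D) UNIV D"
    using D(1) by (rule bij_betw_from_nat_into[rotated])
  moreover have "closure D = \<Lambda>"
    using D closure_minimal[OF D(2) assms(2)] by blast
  ultimately show ?thesis
    by (auto simp: bij_betw_def)
qed

theorem theorem4p3:
  fixes G :: "nat \<Rightarrow> nat \<Rightarrow> bool" and \<Lambda> :: "real set"
  assumes "simple_graph G"
    and "compact \<Lambda>" and "infinite \<Lambda>"
  shows "\<exists>T. bounded_operator T \<and> self_adjoint T \<and>
    op_spectrum T = complex_of_real ` \<Lambda> \<and>
    approx_point_spectrum T = op_spectrum T \<and>
    real_symmetric (standard_matrix T) \<and>
    matrix_has_graph (standard_matrix T) G"
proof -
  obtain \<mu> :: "nat \<Rightarrow> real" where inj: "inj \<mu>" and dense: "closure (range \<mu>) = \<Lambda>"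
    using infinite_closed_imp_dense_injective_sequence[OF assms(3) compact_imp_closed[OF assms(2)]] by blast
  have sub: "range \<mu> \<subseteq> \<Lambda>"
    using closure_subset[of "range \<mu>"] unfolding dense .
  have \<mu>: "bounded (range \<mu>)"
    using compact_imp_bounded[OF assms(2)] sub by (rule bounded_subset)
  \<comment> \<open>A block of size \<open>Suc n\<close> with entries at most \<open>\<eta> n\<close> has norm at most \<open>(1 / 2) ^ n\<close>.\<close>
  define \<eta> :: "nat \<Rightarrow> real" where "\<eta> n = (1 / 2) ^ n / (real (Suc n) * real (Suc n))" for n
  have \<eta>: "0 < \<eta> n" for n
    unfolding \<eta>_def by (intro divide_pos_pos mult_pos_pos) simp_all
  from nested_diagonalised_matrices[where \<eta> = \<eta>, OF inj assms(1) \<eta>]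
  obtain A Q where AQ: "\<forall>n. diagonalises n \<mu> (A n) (Q n) \<and>
    (\<forall>i<n. \<forall>j<n. i \<noteq> j \<longrightarrow> (A n i j \<noteq> 0 \<longleftrightarrow> G i j)) \<and>
    (\<forall>i<Suc n. \<forall>j<Suc n. \<bar>A (Suc n) i j - pad n \<mu> (A n) i j\<bar> \<le> \<eta> n) \<and>
    (\<forall>i<n. \<forall>j<n. i \<noteq> j \<longrightarrow> A (Suc n) i j = A n i j)"
    by (elim exE) (erule that)
  have diag: "diagonalises n \<mu> (A n) (Q n)" for n
    using spec[OF AQ, of n] by (elim conjE)
  have graph: "A n i j \<noteq> 0 \<longleftrightarrow> G i j" if "i < n" "j < n" "i \<noteq> j" for n i j
    using spec[OF AQ, of n] that by blast
  have close: "\<bar>A (Suc n) i j - pad n \<mu> (A n) i j\<bar> \<le> \<eta> n" if "i < Suc n" "j < Suc n" for n i j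
    using spec[OF AQ, of n] that by blast
  have const: "A (Suc n) i j = A n i j" if "i < n" "j < n" "i \<noteq> j" for n i j
    using spec[OF AQ, of n] that by blast
  have A_sym: "A n i j = A n j i" if "i < n" "j < n" for n i j
    using diag[of n] that by (simp add: diagonalises_def mult_ac)
  define T where "T n = Blinfun (real_block_op n (A n) \<mu>)" for n
  have T: "blinfun_apply (T n) x = real_block_op n (A n) \<mu> x" for n x
    by (simp add: T_def bounded_linear_Blinfun_apply bounded_linear_real_block_op \<mu>)
  have step: "norm (T (Suc n) - T n) \<le> (1 / 2) ^ n" for n
  proof (rule norm_blinfun_bound)
    fix x
    have "blinfun_apply (T (Suc n) - T n) x = block_op (Suc n)
        (\<lambda>i j. complex_of_real (A (Suc n) i j) - complex_of_real (pad n \<mu> (A n) i j)) (\<lambda>_. 0) x"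
      unfolding minus_blinfun.rep_eq T real_block_op_Suc[OF \<mu>, of n] unfolding real_block_op_def
      by (rule block_op_minus[OF bounded_range_of_real[OF \<mu>]])
    also have "norm \<dots> \<le> real (Suc n) * real (Suc n) * \<eta> n * norm x"
      by (rule norm_block_op_zero_uniform_le) (simp only: of_real_diff[symmetric] norm_of_real close)
    also have "\<dots> = (1 / 2) ^ n * norm x"
      by (simp add: \<eta>_def del: of_nat_Suc)
    finally show "norm (blinfun_apply (T (Suc n) - T n) x) \<le> (1 / 2) ^ n * norm x" .
  qed simp
  have "summable (\<lambda>n. T (Suc n) - T n)"
    by (rule summable_comparison_test'[OF summable_geometric[of "1 / 2 :: real"] step]) simp
  then have "convergent (\<lambda>n. T n - T 0)"
    unfolding summable_iff_convergent sum_lessThan_telescope .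
  then obtain L' where L': "(\<lambda>n. T n - T 0) \<longlonglongrightarrow> L'"
    by (auto simp: convergent_def)
  define L where "L = L' + T 0"
  have L: "T \<longlonglongrightarrow> L"
    using tendsto_add[OF L' tendsto_const[of "T 0"]] by (simp add: L_def)
  define e where "e n = norm (L - T n)" for n
  have e: "e \<longlonglongrightarrow> 0" "\<And>n. 0 \<le> e n"
    using tendsto_norm_zero[OF LIM_zero[OF L]] by (simp_all add: e_def[abs_def] norm_minus_commute)
  have approx: "norm (blinfun_apply L x - real_block_op n (A n) \<mu> x) \<le> e n * norm x" for n x
    using norm_blinfun[of "L - T n" x] by (simp add: e_def minus_blinfun.rep_eq T)
  have lim: "(\<lambda>n. real_block_op n (A n) \<mu> x) \<longlonglongrightarrow> blinfun_apply L x" for x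
    using blinfun.tendsto[OF L tendsto_const[of x]] by (simp add: T)
  have bounded: "bounded_operator (blinfun_apply L)"
    unfolding bounded_operator_def
  proof (intro conjI allI)
    fix c x
    have "(\<lambda>n. c *\<^sub>C real_block_op n (A n) \<mu> x) \<longlonglongrightarrow> c *\<^sub>C blinfun_apply L x"
      by (rule bounded_linear.tendsto[OF bounded_linear_scale_ell2 lim])
    moreover have "c *\<^sub>C real_block_op n (A n) \<mu> x = real_block_op n (A n) \<mu> (c *\<^sub>C x)" for n
      using bounded_operator_real_block_op[OF \<mu>] by (simp add: bounded_operator_def)
    ultimately show "blinfun_apply L (c *\<^sub>C x) = c *\<^sub>C blinfun_apply L x"
      using lim[of "c *\<^sub>C x"] LIMSEQ_unique by simp
  qed (rule blinfun.bounded_linear_right)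
  have sa: "self_adjoint (blinfun_apply L)"
    unfolding self_adjoint_def
  proof (intro allI)
    fix x y
    have transpose: "real_block_op n (\<lambda>i j. A n j i) \<mu> = real_block_op n (A n) \<mu>" for n
      by (intro ext ell2_eqI) (simp add: ell2_nth_real_block_op[OF \<mu>] A_sym)
    have "(\<lambda>n. cinner_ell2 (real_block_op n (A n) \<mu> x) y) \<longlonglongrightarrow> cinner_ell2 (blinfun_apply L x) y"
      by (rule bounded_bilinear.tendsto[OF bounded_bilinear_cinner_ell2 lim tendsto_const])
    moreover have "(\<lambda>n. cinner_ell2 (real_block_op n (A n) \<mu> x) y) \<longlonglongrightarrow> cinner_ell2 x (blinfun_apply L y)"
      unfolding real_block_op_adjoint[OF \<mu>] transpose
      by (rule bounded_bilinear.tendsto[OF bounded_bilinear_cinner_ell2 tendsto_const lim])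
    ultimately show "cinner_ell2 (blinfun_apply L x) y = cinner_ell2 x (blinfun_apply L y)"
      by (rule LIMSEQ_unique)
  qed
  define M where "M = standard_matrix (blinfun_apply L)"
  have entries: "(\<lambda>n. complex_of_real (A n i j)) \<longlonglongrightarrow> M i j" for i j
  proof -
    have "(\<lambda>n. ell2_nth (real_block_op n (A n) \<mu> (basis_ell2 j)) i) \<longlonglongrightarrow> M i j"
      unfolding M_def standard_matrix_def cinner_basis_ell2
      by (rule bounded_linear.tendsto[OF bounded_linear_ell2_nth lim])
    moreover have "\<forall>\<^sub>F n in sequentially. ell2_nth (real_block_op n (A n) \<mu> (basis_ell2 j)) i = complex_of_real (A n i j)"
      using eventually_gt_at_top[of "max i j"]
      by eventually_elim (simp add: ell2_nth_real_block_op[OF \<mu>])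
    ultimately show ?thesis
      by (rule Lim_transform_eventually)
  qed
  have real_sym: "real_symmetric M"
    unfolding real_symmetric_def
  proof (intro allI conjI)
    fix i j
    show "M i j \<in> \<real>"
      by (rule closed_sequentially[OF closed_complex_Reals _ entries]) simp
    have "\<forall>\<^sub>F n in sequentially. complex_of_real (A n i j) = complex_of_real (A n j i)"
      using eventually_gt_at_top[of "max i j"] by eventually_elim (simp add: A_sym)
    then have "(\<lambda>n. complex_of_real (A n j i)) \<longlonglongrightarrow> M i j"
      by (rule Lim_transform_eventually[OF entries])
    then show "M i j = M j i"
      using entries LIMSEQ_unique by blast
  qed
  have "M i j \<noteq> 0 \<longleftrightarrow> G i j" if "i \<noteq> j" for i j
  proof -
    define m where "m = Suc (max i j)"
    have stable: "A n i j = A m i j" if "m \<le> n" for n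
      using that
    proof (induction n rule: dec_induct)
      case (step n)
      then show ?case using const[of i n j] \<open>i \<noteq> j\<close> by (simp add: m_def)
    qed simp
    have "\<forall>\<^sub>F n in sequentially. complex_of_real (A n i j) = complex_of_real (A m i j)"
      using eventually_ge_at_top[of m] by eventually_elim (rule arg_cong[OF stable])
    then have "(\<lambda>n. complex_of_real (A m i j)) \<longlonglongrightarrow> M i j"
      by (rule Lim_transform_eventually[OF entries])
    then have "M i j = complex_of_real (A m i j)"
      by (simp add: LIMSEQ_const_iff)
    then show ?thesis
      using graph[of i m j] that by (simp add: m_def)
  qed
  then have graph_M: "matrix_has_graph M G"
    unfolding matrix_has_graph_def submatrix_has_graph_def by blast
  have "op_spectrum (blinfun_apply L) \<subseteq> complex_of_real ` \<Lambda>"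
    by (rule op_spectrum_limit_subset[OF bounded \<mu> diag approx e(2,1) assms(2) sub])
  moreover have "complex_of_real ` \<Lambda> \<subseteq> approx_point_spectrum (blinfun_apply L)"
    using closure_subset_approx_point_spectrum_limit[OF \<mu> diag approx e(1)] unfolding dense .
  ultimately have "op_spectrum (blinfun_apply L) = complex_of_real ` \<Lambda>"
    "approx_point_spectrum (blinfun_apply L) = op_spectrum (blinfun_apply L)"
    using approx_point_spectrum_subset[of "blinfun_apply L"] by auto
  then show ?thesis
    using bounded sa real_sym graph_M unfolding M_def by blast
qed

end
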